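(* Assume that (A1)–(A5), as written out in the context, hold, fix $t>0$, and let $m(\cdot)$, $\tilde r$, $h$, $n_0$ be as defined in the context. For $1\le i\le n_0$ and $t_{i-1}<s\le t_i$, $$m(s)=\int_s^{t_i}\tilde r(u)\,du+\int_s^{t_i}Q(u)m(u)\,du+m(t_i),$$ where $m(t_{n_0})=0$. Furthermore, $m(\cdot)$ is a.e. differentiable, and for $1\le i\le n_0$ and $0\le s<t_i-t_{i-1}$, $$\frac{d}{ds}m(t_i-s)=\tilde r(t_i-s)+Q(t_i-s)m(t_i-s)\quad\text{a.e.},$$ and $m(t_i)=h(t_i)+m(t_i+)$ (where $m(t+)=0$).
   Context: Setting. $X=(X(t):t\ge 0)$ is a right-continuous Markov jump process on a finite set $S$, $|S|=d<\infty$, with time-dependent rate matrices $Q(t)=(Q(t,x,y):x,y\in S)$ (nonnegative off-diagonal entries, rows summing to $0$) and transition matrices $P(s,t)=(P(s,t,x,y):x,y\in S)$, $P(s,t,x,y)=\mathbb P(X(t)=y\mid X(s)=x)$, $0\le s\le t$. $r(t,x)$ is a reward rate function, $\beta(t,x)$ an intensity function, and $G(t,x,y,\cdot)$, $H(t,x,\cdot)$, $K(t,x,\cdot)$ ($t\ge0$, $x,y\in S$) are given families of distribution functions (of lump-sum rewards received respectively at a jump of $X$ from $x$ to $y$ at time $t$; at a scheduled time $t$ with $X(t)=x$; at an event time $t$, with $X(t)=x$, of a Poisson process with intensity $\beta(t,X(t))$). $0=t_0<t_1<t_2<\cdots$ are deterministic scheduled times with $t_i\to\infty$, and $n(t)=\sup\{i\ge0:t_i\le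 t\}$. Functions on $S$ are column vectors. Assumptions. (A1) For $x,y\in S$, $z\in\mathbb R$, the functions $Q(\cdot,x,y)$, $r(\cdot,x)$, $G(\cdot,x,y,z)$, $K(\cdot,x,z)$, $\beta(\cdot,x)$ are measurable. (A2) $\mathcal B=\{(x,y):Q(t,x,y)>0\}$ does not depend on $t$, and $Q(1)$ (hence every $Q(t)$) is an irreducible rate matrix. (A3) For each $(x,y)\in\mathcal B$, $0<\inf_{t\ge0}Q(t,x,y)\le\sup_{t\ge0}Q(t,x,y)<\infty$. (A4) There is a finite-valued function $c=(c(x):x\in S)$ such that for all $x\in S$ (and $y \in S$): $0\le\inf_{t}r(t,x)\le\sup_t r(t,x)<\infty$; $0\le\inf_t\beta(t,x)\le\sup_t\beta(t,x)<\infty$; $\sup_t G(t,x,y,0-)=0$ and $\inf_t G(t,x,y,c(x))=1$; $\sup_t H(t,x,0-)=0$ and $\inf_t H(t,x,c(x))=1$; $\sup_t K(t,x,0-)=0$ and $\inf_t K(t,x,c(x))=1$ (i.e. lump-sum rewards take values in $[0,c(x)]$). Moreover, with $\gamma_1(t,x)=\sum_{y:(x,y)\in\mathcal B}Q(t,x,y)\int_0^\infty zG(t,x,y,dz)$, $\gamma_2(t,x)=\beta(t,x)\int_0^\infty zK(t,x,dz)$ and $\gamma=\gamma_1+\gamma_2$, one has $\inf_{t\ge0}r(t,x)+\inf_{t\ge0}\gamma(t,x)>0$ for all $x\in S$. (A5) $\inf\{t_i-t_{i-1}:i\ge1\}>0$. Definitions for fixed $t>0$. $\tilde r(u,x)=r(u,x)+\gamma(u,x)$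 and $h(t_i,x)=\int_0^\infty zH(t_i,x,dz)$. Let $n_0=n(t)+1$; for the purposes of this statement the scheduled times up to $t$ are taken to be $t_0=0,t_1,\dots,t_{n_0-1}$, together with $t_{n_0}=t$ (replacing the original $t_{n_0}$), with the convention $h(t_0)=h(0)\equiv0$ and $h(t_{n_0})=h(t)\equiv0$. For $0\le s\le t$, the vector $m(s)=(m(s,x):x\in S)$ is $$m(s)=\int_s^tP(s,u)\tilde r(u)\,du+\sum_{s\le t_i\le t}P(s,t_i)h(t_i).$$ $m(s+)$ denotes the right limit of $m$ at $s<t$. *)

theory Defs
  imports "HOL-Probability.Probability"
begin

definition rate_matrix :: "real^'s::finite^'s \<Rightarrow> bool" where
  "rate_matrix A \<longleftrightarrow>
     (\<forall>x y. x \<noteq> y \<longrightarrow> 0 \<le> A $ x $ y) \<and> (\<forall>x. (\<Sum>y\<in>UNIV. A $ x $ y) = 0)"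

definition positive_rates :: "real^'s::finite^'s \<Rightarrow> ('s \<times> 's) set" where
  "positive_rates A = {(x, y). A $ x $ y > 0}"

definition irreducible_rate_matrix :: "real^'s::finite^'s \<Rightarrow> bool" where
  "irreducible_rate_matrix A \<longleftrightarrow>
     rate_matrix A \<and> (\<forall>x y. (x, y) \<in> (positive_rates A)\<^sup>*)"

definition stochastic_matrix :: "real^'s::finite^'s \<Rightarrow> bool" where
  "stochastic_matrix A \<longleftrightarrow>
     (\<forall>x y. 0 \<le> A $ x $ y) \<and> (\<forall>x. (\<Sum>y\<in>UNIV. A $ x $ y) = 1)"

definition natural_filtration ::
    "'w measure \<Rightarrow> (real \<Rightarrow> 'w \<Rightarrow> 's) \<Rightarrow> real \<Rightarrow> 'w measure" where
  "natural_filtration M X s =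
     sigma (space M) {X u -` {y} \<inter> space M | u y. 0 \<le> u \<and> u \<le> s}"

text \<open>
  A right-continuous Markov jump process on the finite state space \<open>'s\<close>.
  The matrices \<open>P s t\<close> form a transition function, so that the entry
  \<open>P s t $ x $ y\<close>, the conditional probability of \<open>X t = y\<close> given \<open>X s = x\<close>, makes sense
  also if the event \<open>X s = x\<close> is null.
  The rate matrices are only assumed measurable in time, so that the local description
  \<open>P s (s + e) = 1 + e Q(s) + o(e)\<close> can be required only for almost every \<open>s\<close>, and would then
  not determine \<open>P\<close>. As usual, having rates \<open>Q\<close> therefore means that \<open>P s\<close> is absolutely
  continuous and solves the Kolmogorov forward equation, i.e. Dynkin's formula: the expectation
  of \<open>f (X t)\<close> given \<open>X s = x\<close> is \<open>f x\<close> plus the integral over \<open>u\<close> from \<open>s\<close> to \<open>t\<close> of the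
  expectation of \<open>(Q u *v f) (X u)\<close>.
\<close>

locale markov_jump_process = prob_space M for M :: "'w measure" +
  fixes X :: "real \<Rightarrow> 'w \<Rightarrow> 's::finite"
    and Q :: "real \<Rightarrow> real^'s^'s"
    and P :: "real \<Rightarrow> real \<Rightarrow> real^'s^'s"
  assumes X_measurable: "\<And>t. 0 \<le> t \<Longrightarrow> X t \<in> measurable M (count_space UNIV)"
    and X_right_continuous:
      "\<And>t \<omega>. 0 \<le> t \<Longrightarrow> \<omega> \<in> space M \<Longrightarrow> \<forall>\<^sub>F u in at_right t. X u \<omega> = X t \<omega>"
    and rate_matrix_Q: "\<And>t. 0 \<le> t \<Longrightarrow> rate_matrix (Q t)"
    and stochastic_P: "\<And>s t. 0 \<le> s \<Longrightarrow> s \<le> t \<Longrightarrow> stochastic_matrix (P s t)"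
    and P_same: "\<And>s. 0 \<le> s \<Longrightarrow> P s s = mat 1"
    and Chapman_Kolmogorov:
      "\<And>s u t. 0 \<le> s \<Longrightarrow> s \<le> u \<Longrightarrow> u \<le> t \<Longrightarrow> P s t = P s u ** P u t"
    and Markov_property:
      "\<And>s t y. 0 \<le> s \<Longrightarrow> s \<le> t \<Longrightarrow>
         AE \<omega> in M. real_cond_exp M (natural_filtration M X s)
           (indicator {\<omega> \<in> space M. X t \<omega> = y}) \<omega> = P s t $ X s \<omega> $ y"
    and forward_integrable:
      "\<And>s t. 0 \<le> s \<Longrightarrow> s \<le> t \<Longrightarrow> set_integrable lborel {s..t} (\<lambda>u. P s u ** Q u)"
    and forward_equation:
      "\<And>s t. 0 \<le> s \<Longrightarrow> s \<le> t \<Longrightarrow> P s t = mat 1 + (LINT u:{s..t}|lborel. P s u ** Q u)"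

definition distribution_function :: "(real \<Rightarrow> real) \<Rightarrow> bool" where
  "distribution_function F \<longleftrightarrow>
     mono F \<and> (\<forall>a. continuous (at_right a) F) \<and> (F \<longlongrightarrow> 0) at_bot \<and> (F \<longlongrightarrow> 1) at_top"

definition mean_of_df :: "(real \<Rightarrow> real) \<Rightarrow> real" where
  "mean_of_df F = (LINT z:{0..}|interval_measure F. z)"

text \<open>
  The lump-sum rewards at jumps, at the scheduled times \<open>T\<close>, and at the events of the Poisson
  process have the distribution functions \<open>G\<close>, \<open>H\<close> and \<open>K\<close>. The reward rate and the Poisson
  intensity are not parameters here because all conditions on them are stated separately below.
\<close>

locale markov_reward_process = markov_jump_process M X Q P
  for M :: "'w measure" and X :: "real \<Rightarrow> 'w \<Rightarrow> 's::finite"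
    and Q :: "real \<Rightarrow> real^'s^'s" and P :: "real \<Rightarrow> real \<Rightarrow> real^'s^'s" +
  fixes G :: "real \<Rightarrow> 's \<Rightarrow> 's \<Rightarrow> real \<Rightarrow> real"
    and H K :: "real \<Rightarrow> 's \<Rightarrow> real \<Rightarrow> real"
    and T :: "nat \<Rightarrow> real"
  assumes df_G: "\<And>t x y. 0 \<le> t \<Longrightarrow> distribution_function (G t x y)"
    and df_H: "\<And>t x. 0 \<le> t \<Longrightarrow> distribution_function (H t x)"
    and df_K: "\<And>t x. 0 \<le> t \<Longrightarrow> distribution_function (K t x)"
    and T_0: "T 0 = 0"
    and T_strict_mono: "strict_mono T"
    and T_unbounded: "filterlim T at_top sequentially"

definition gamma1 ::
    "(real \<Rightarrow> real^'s::finite^'s) \<Rightarrow> (real \<Rightarrow> 's \<Rightarrow> 's \<Rightarrow> real \<Rightarrow> real) \<Rightarrow> real \<Rightarrow> 's \<Rightarrow> real" where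
  "gamma1 Q G t x =
     (\<Sum>y | (x, y) \<in> positive_rates (Q t). Q t $ x $ y * mean_of_df (G t x y))"

definition gamma2 ::
    "(real \<Rightarrow> 's \<Rightarrow> real) \<Rightarrow> (real \<Rightarrow> 's \<Rightarrow> real \<Rightarrow> real) \<Rightarrow> real \<Rightarrow> 's \<Rightarrow> real" where
  "gamma2 \<beta> K t x = \<beta> t x * mean_of_df (K t x)"

definition gamma_rate ::
    "(real \<Rightarrow> real^'s::finite^'s) \<Rightarrow> (real \<Rightarrow> 's \<Rightarrow> real) \<Rightarrow> (real \<Rightarrow> 's \<Rightarrow> 's \<Rightarrow> real \<Rightarrow> real) \<Rightarrow>
     (real \<Rightarrow> 's \<Rightarrow> real \<Rightarrow> real) \<Rightarrow> real \<Rightarrow> 's \<Rightarrow> real" where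
  "gamma_rate Q \<beta> G K t x = gamma1 Q G t x + gamma2 \<beta> K t x"

definition A1 ::
    "(real \<Rightarrow> real^'s::finite^'s) \<Rightarrow> (real \<Rightarrow> 's \<Rightarrow> real) \<Rightarrow> (real \<Rightarrow> 's \<Rightarrow> real) \<Rightarrow>
     (real \<Rightarrow> 's \<Rightarrow> 's \<Rightarrow> real \<Rightarrow> real) \<Rightarrow> (real \<Rightarrow> 's \<Rightarrow> real \<Rightarrow> real) \<Rightarrow> bool" where
  "A1 Q r \<beta> G K \<longleftrightarrow>
     (\<forall>x y z.
        (\<lambda>t. Q t $ x $ y) \<in> borel_measurable (restrict_space borel {0..}) \<and>
        (\<lambda>t. r t x) \<in> borel_measurable (restrict_space borel {0..}) \<and>
        (\<lambda>t. G t x y z) \<in> borel_measurable (restrict_space borel {0..}) \<and>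
        (\<lambda>t. K t x z) \<in> borel_measurable (restrict_space borel {0..}) \<and>
        (\<lambda>t. \<beta> t x) \<in> borel_measurable (restrict_space borel {0..}))"

definition A2 :: "(real \<Rightarrow> real^'s::finite^'s) \<Rightarrow> bool" where
  "A2 Q \<longleftrightarrow>
     (\<forall>s\<ge>0. \<forall>t\<ge>0. positive_rates (Q s) = positive_rates (Q t)) \<and>
     irreducible_rate_matrix (Q 1)"

text \<open>
  Infima and suprema over time are taken in the extended reals, where they always exist.
  In \<open>A3\<close> the time at which \<open>positive_rates\<close> is taken is immaterial by \<open>A2\<close>.
\<close>

definition A3 :: "(real \<Rightarrow> real^'s::finite^'s) \<Rightarrow> bool" where
  "A3 Q \<longleftrightarrow>
     (\<forall>(x, y) \<in> positive_rates (Q 1).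
        0 < (INF t\<in>{0..}. ereal (Q t $ x $ y)) \<and> (SUP t\<in>{0..}. ereal (Q t $ x $ y)) < \<infinity>)"

definition A4 ::
    "(real \<Rightarrow> real^'s::finite^'s) \<Rightarrow> (real \<Rightarrow> 's \<Rightarrow> real) \<Rightarrow> (real \<Rightarrow> 's \<Rightarrow> real) \<Rightarrow>
     (real \<Rightarrow> 's \<Rightarrow> 's \<Rightarrow> real \<Rightarrow> real) \<Rightarrow> (real \<Rightarrow> 's \<Rightarrow> real \<Rightarrow> real) \<Rightarrow>
     (real \<Rightarrow> 's \<Rightarrow> real \<Rightarrow> real) \<Rightarrow> bool" where
  "A4 Q r \<beta> G H K \<longleftrightarrow>
     (\<exists>c :: 's \<Rightarrow> real. \<forall>x y.
        0 \<le> (INF t\<in>{0..}. ereal (r t x)) \<and> (SUP t\<in>{0..}. ereal (r t x)) < \<infinity> \<and>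
        0 \<le> (INF t\<in>{0..}. ereal (\<beta> t x)) \<and> (SUP t\<in>{0..}. ereal (\<beta> t x)) < \<infinity> \<and>
        (SUP t\<in>{0..}. ereal (Lim (at_left 0) (G t x y))) = 0 \<and>
        (INF t\<in>{0..}. ereal (G t x y (c x))) = 1 \<and>
        (SUP t\<in>{0..}. ereal (Lim (at_left 0) (H t x))) = 0 \<and>
        (INF t\<in>{0..}. ereal (H t x (c x))) = 1 \<and>
        (SUP t\<in>{0..}. ereal (Lim (at_left 0) (K t x))) = 0 \<and>
        (INF t\<in>{0..}. ereal (K t x (c x))) = 1) \<and>
     (\<forall>x. (INF t\<in>{0..}. ereal (r t x)) + (INF t\<in>{0..}. ereal (gamma_rate Q \<beta> G K t x)) > 0)"

definition A5 :: "(nat \<Rightarrow> real) \<Rightarrow> bool" where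
  "A5 T \<longleftrightarrow> (INF i\<in>{1..}. ereal (T i - T (i - 1))) > 0"

definition r_tilde ::
    "(real \<Rightarrow> real^'s::finite^'s) \<Rightarrow> (real \<Rightarrow> 's \<Rightarrow> real) \<Rightarrow> (real \<Rightarrow> 's \<Rightarrow> real) \<Rightarrow>
     (real \<Rightarrow> 's \<Rightarrow> 's \<Rightarrow> real \<Rightarrow> real) \<Rightarrow> (real \<Rightarrow> 's \<Rightarrow> real \<Rightarrow> real) \<Rightarrow> real \<Rightarrow> real^'s" where
  "r_tilde Q r \<beta> G K u = (\<chi> x. r u x + gamma_rate Q \<beta> G K u x)"

definition num_scheduled :: "(nat \<Rightarrow> real) \<Rightarrow> real \<Rightarrow> nat" where
  "num_scheduled T t = Sup {i. T i \<le> t}"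

text \<open>
  The scheduled times up to the horizon \<open>t\<close>, where \<open>t\<close> itself replaces the first scheduled time
  beyond \<open>t\<close>.
\<close>

definition truncated_schedule :: "(nat \<Rightarrow> real) \<Rightarrow> real \<Rightarrow> nat \<Rightarrow> real" where
  "truncated_schedule T t i = (if i < num_scheduled T t + 1 then T i else t)"

text \<open>
  The convention that there is no lump sum at times \<open>0\<close> and \<open>t\<close> refers to the times, not to the
  indices: if \<open>t\<close> happens to be a scheduled time, its lump sum is dropped as well.
\<close>

definition lump_mean ::
    "(real \<Rightarrow> 's::finite \<Rightarrow> real \<Rightarrow> real) \<Rightarrow> real \<Rightarrow> real \<Rightarrow> real^'s" where
  "lump_mean H t u = (if u = 0 \<or> u = t then 0 else (\<chi> x. mean_of_df (H u x)))"

definition mean_reward ::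
    "(real \<Rightarrow> real \<Rightarrow> real^'s::finite^'s) \<Rightarrow> (real \<Rightarrow> real^'s) \<Rightarrow> (real \<Rightarrow> real^'s) \<Rightarrow>
     (nat \<Rightarrow> real) \<Rightarrow> nat \<Rightarrow> real \<Rightarrow> real \<Rightarrow> real^'s" where
  "mean_reward P rt h \<tau> n\<^sub>0 t s =
     (LINT u:{s..t}|lborel. P s u *v rt u) +
     (\<Sum>i | i \<le> n\<^sub>0 \<and> s \<le> \<tau> i \<and> \<tau> i \<le> t. P s (\<tau> i) *v h (\<tau> i))"

end

theory Submission
  imports Defs
begin

text \<open>
  Between scheduled times the reward vector satisfies the cocycle identity
  \<open>m s = (\<integral>u=s..s'. P s u rt u) + P s s' m s'\<close>. Only the forward equation and the boundedness of the
  rates are needed to turn this into the backward equation: the difference \<open>F\<close> of its two sides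
  satisfies \<open>norm (F s - F s') \<le> K (s' - s)\<^sup>2\<close>, hence is constant. Almost everywhere
  differentiability is then Lebesgue's theorem for indefinite integrals, and the jump of \<open>m\<close> at a
  scheduled time is the single lump sum that drops out of the sum there.
\<close>

text \<open>Differentiating \<open>P s u\<close> in its first argument would call for the Kolmogorov
  backward equation, whereas the process is specified by the forward equation, which moves the
  second argument. The cocycle identity removes this obstacle: over a short interval from
  \<open>x\<close> to \<open>y\<close> it expresses the increment of \<open>m\<close> through
  \<open>P x u\<close> with \<open>u\<close> between \<open>x\<close> and \<open>y\<close>, and
  there \<open>P x u\<close> is \<open>1 + O(u - x)\<close> uniformly. As the rates are merely
  measurable in time, \<open>m\<close> need not be differentiable at a given point, so increments
  are compared and not derivatives. The other obstacle sits at the scheduled times. There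
  \<open>m\<close> is left-continuous but may jump, so the cocycle identity can fail at the left end
  of an interval between scheduled times. The analysis therefore concerns a modification of
  \<open>m\<close> on the closed interval, whose value at the left end is the right limit of
  \<open>m\<close>. If \<open>t\<close> is itself a scheduled time, the last two entries of the
  schedule coincide and the last interval is empty.\<close>

section \<open>Real analysis: derivatives of indefinite integrals, and a criterion for
  constancy\<close>

text \<open>\<open>integrable_ccontinuous_explicit\<close> controls averages over intervals to the
  right of a point. Applied to \<open>g\<close> and to its reflection it yields both one-sided
  derivatives; \<open>N2\<close> belongs to the reflection and has to be reflected back. The minus
  sign reflects that the lower limit varies.\<close>

lemma indefinite_integral_has_vector_derivative_ae:
  fixes f :: "real \<Rightarrow> 'b::euclidean_space"
  assumes f: "f integrable_on {a..b}"
  obtains N where "negligible N"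
    and "\<And>x. \<lbrakk>x \<in> {a<..<b}; x \<notin> N\<rbrakk> \<Longrightarrow>
      ((\<lambda>s. integral {s..b} f) has_vector_derivative - f x) (at x)"
proof -
  \<comment> \<open>Extension by zero, because integrability on every box is required.\<close>
  define g where "g = (\<lambda>x. if x \<in> {a..b} then f x else 0)"
  have "g integrable_on UNIV"
    using f unfolding g_def by (simp only: integrable_restrict_UNIV)
  then have g: "g integrable_on cbox c d" for c d
    using integrable_on_subcbox by blast
  then have g_refl: "(\<lambda>x. g (- x)) integrable_on cbox c d" for c d
    using integrable_reflect[where f = g and a = "- d" and b = "- c"] g[of "- d" "- c"] by simp
  obtain N1 where N1: "negligible N1"
    "\<And>x e. \<lbrakk>x \<notin> N1; 0 < e\<rbrakk> \<Longrightarrow> \<exists>d>0. \<forall>h. 0 < h \<and> h < d \<longrightarrow>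
        norm (integral {x..x + h} g /\<^sub>R h - g x) < e"
    using integrable_ccontinuous_explicit[OF g] by (auto simp: cbox_interval)
  obtain N2 where N2: "negligible N2"
    "\<And>x e. \<lbrakk>x \<notin> N2; 0 < e\<rbrakk> \<Longrightarrow> \<exists>d>0. \<forall>h. 0 < h \<and> h < d \<longrightarrow>
        norm (integral {x..x + h} (\<lambda>x. g (- x)) /\<^sub>R h - g (- x)) < e"
    using integrable_ccontinuous_explicit[OF g_refl] by (auto simp: cbox_interval)
  have scaled: "norm (v - h *\<^sub>R w) \<le> e * h" if "norm (v /\<^sub>R h - w) < e" "0 < h"
    for v w :: 'b and h e :: real
  proof -
    have "v - h *\<^sub>R w = h *\<^sub>R (v /\<^sub>R h - w)"
      using that by (simp add: algebra_simps)
    then have "norm (v - h *\<^sub>R w) = h * norm (v /\<^sub>R h - w)"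
      using that by (metis abs_of_pos norm_scaleR)
    with that show ?thesis
      by (simp add: mult.commute)
  qed
  have "negligible (N1 \<union> uminus ` N2)"
    using N1(1) N2(1) by (intro negligible_Un negligible_differentiable_image_negligible) (auto intro!: derivative_intros)
  moreover have "((\<lambda>s. integral {s..b} f) has_vector_derivative - f x) (at x)"
    if x: "x \<in> {a<..<b}" and xN: "x \<notin> N1 \<union> uminus ` N2" for x
    unfolding has_vector_derivative_def has_derivative_at_alt
  proof (intro conjI allI impI)
    show "bounded_linear (\<lambda>h. h *\<^sub>R - f x)"
      by (intro bounded_linear_intros)
    fix e :: real assume e: "e > 0"
    obtain d1 where d1: "d1 > 0" "\<And>h. \<lbrakk>0 < h; h < d1\<rbrakk> \<Longrightarrow> norm (integral {x..x + h} g /\<^sub>R h - g x) < e"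
      using N1(2)[of x e] xN e by auto
    have "- x \<notin> N2"
      using xN by (auto simp: image_iff)
    then obtain d2 where d2: "d2 > 0"
      "\<And>h. \<lbrakk>0 < h; h < d2\<rbrakk> \<Longrightarrow> norm (integral {-x..-x + h} (\<lambda>x. g (- x)) /\<^sub>R h - g x) < e"
      using N2(2)[of "-x" e] e by auto
    \<comment> \<open>The last two entries keep \<open>y\<close> inside \<open>{a..b}\<close>, where
      \<open>g\<close> agrees with \<open>f\<close>.\<close>
    define d where "d = Min {d1, d2, x - a, b - x}"
    have "d > 0" and d: "d \<le> d1" "d \<le> d2" "d \<le> x - a" "d \<le> b - x"
      using d1 d2 x by (auto simp: d_def)
    have fg: "integral {c..c'} g = integral {c..c'} f" if "a \<le> c" "c' \<le> b" for c c'
      using that by (intro integral_cong) (auto simp: g_def)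
    have fx: "g x = f x" using x by (simp add: g_def)
    have combine: "integral {c..b} f = integral {c..c'} f + integral {c'..b} f"
      if "a \<le> c" "c \<le> c'" "c' \<le> b" for c c'
      using that by (intro Henstock_Kurzweil_Integration.integral_combine[symmetric] integrable_on_subinterval[OF f]) auto
    have "norm (integral {y..b} f - integral {x..b} f - (y - x) *\<^sub>R - f x) \<le> e * norm (y - x)"
      if y: "norm (y - x) < d" for y
    proof (cases x y rule: linorder_cases)
      case less
      then have "integral {x..b} f - integral {y..b} f = integral {x..x + (y - x)} g"
        using combine[of x y] fg[of x y] x y d by auto
      moreover have "norm (integral {x..x + (y - x)} g - (y - x) *\<^sub>R f x) \<le> e * (y - x)"
        using less y d d1(2)[of "y - x"] by (intro scaled) (auto simp: fx)
      ultimately show ?thesis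
        using less by (simp add: norm_minus_commute algebra_simps)
    next
      case equal
      then show ?thesis by simp
    next
      case greater
      have "integral {y..b} f - integral {x..b} f = integral {y..x} g"
        using combine[of y x] fg[of y x] greater x y d by auto
      also have "\<dots> = integral {-x..-y} (\<lambda>x. g (- x))"
        by (simp add: Henstock_Kurzweil_Integration.integral_reflect_real[of x y g])
      finally have "integral {y..b} f - integral {x..b} f = integral {-x..-x + (x - y)} (\<lambda>x. g (- x))"
        by simp
      moreover have "norm (integral {-x..-x + (x - y)} (\<lambda>x. g (- x)) - (x - y) *\<^sub>R f x) \<le> e * (x - y)"
        using greater y d d2(2)[of "x - y"] by (intro scaled) (auto simp: fx)
      ultimately show ?thesis
        using greater by (simp add: algebra_simps)
    qed
    then show "\<exists>d>0. \<forall>y. norm (y - x) < d \<longrightarrow>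
        norm (integral {y..b} f - integral {x..b} f - (y - x) *\<^sub>R - f x) \<le> e * norm (y - x)"
      using \<open>d > 0\<close> by blast
  qed
  ultimately show ?thesis
    using that by blast
qed

text \<open>Difference quotients are \<open>O(y - x)\<close>, so the derivative vanishes at every
  point of the convex set.\<close>

lemma quadratic_increments_imp_constant:
  fixes F :: "real \<Rightarrow> 'b::real_normed_vector"
  assumes "convex S"
    and incr: "\<And>x y. \<lbrakk>x \<in> S; y \<in> S; x \<le> y\<rbrakk> \<Longrightarrow> norm (F x - F y) \<le> K * (y - x)\<^sup>2"
    and "x \<in> S" "y \<in> S"
  shows "F x = F y"
proof -
  \<comment> \<open>The sign of \<open>K\<close> is unknown and \<open>incr\<close> covers ordered
    pairs; the absolute values make the bound symmetric.\<close>
  have K: "norm (F y - F x) \<le> \<bar>K\<bar> * \<bar>y - x\<bar> * \<bar>y - x\<bar>" if "x \<in> S" "y \<in> S" for x y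
  proof -
    have "norm (F y - F x) \<le> K * (y - x)\<^sup>2"
      using incr[of x y] incr[of y x] that by (cases "x \<le> y") (auto simp: norm_minus_commute power2_commute)
    also have "\<dots> \<le> \<bar>K\<bar> * (y - x)\<^sup>2"
      by (intro mult_right_mono) auto
    finally show ?thesis
      by (simp add: power2_eq_square mult.assoc)
  qed
  have "(F has_derivative (\<lambda>h. 0)) (at x within S)" if x: "x \<in> S" for x
    unfolding has_derivative_within_alt
  proof (intro conjI allI impI bounded_linear_zero)
    fix e :: real assume e: "e > 0"
    have "norm (F y - F x - 0) \<le> e * norm (y - x)"
      if y: "y \<in> S" "norm (y - x) < e / (\<bar>K\<bar> + 1)" for y
    proof -
      have "\<bar>K\<bar> * \<bar>y - x\<bar> \<le> (\<bar>K\<bar> + 1) * (e / (\<bar>K\<bar> + 1))"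
        using y by (intro mult_mono) auto
      then have "\<bar>K\<bar> * \<bar>y - x\<bar> * \<bar>y - x\<bar> \<le> e * \<bar>y - x\<bar>"
        by (intro mult_right_mono) auto
      with K[OF x y(1)] show ?thesis
        by simp
    qed
    then show "\<exists>d>0. \<forall>y\<in>S. norm (y - x) < d \<longrightarrow> norm (F y - F x - 0) \<le> e * norm (y - x)"
      using e by (intro exI[of _ "e / (\<bar>K\<bar> + 1)"]) auto
  qed
  with has_derivative_zero_constant[OF \<open>convex S\<close>] obtain c where "\<forall>x\<in>S. F x = c"
    by blast
  with \<open>x \<in> S\<close> \<open>y \<in> S\<close> show ?thesis by simp
qed

section \<open>Norms, measurability and integrals of matrix-vector products\<close>

lemma norm_matrix_le_sum:
  fixes A :: "real^'n::finite^'m::finite"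
  shows "norm A \<le> (\<Sum>i\<in>UNIV. \<Sum>j\<in>UNIV. \<bar>A $ i $ j\<bar>)"
proof -
  have "norm A \<le> (\<Sum>i\<in>UNIV. norm (A $ i))"
    by (simp add: norm_vec_def L2_set_le_sum)
  also have "\<dots> \<le> (\<Sum>i\<in>UNIV. \<Sum>j\<in>UNIV. \<bar>A $ i $ j\<bar>)"
    by (intro sum_mono norm_le_l1_cart)
  finally show ?thesis .
qed

text \<open>The norm of \<open>real^'n^'m\<close> is the Frobenius norm, the Euclidean norm of the
  row norms, so Cauchy-Schwarz in each row suffices.\<close>

lemma norm_matrix_vector_mult_le:
  fixes A :: "real^'n::finite^'m::finite"
  shows "norm (A *v x) \<le> norm A * norm x"
proof -
  have "norm (A *v x) = L2_set (\<lambda>i. \<bar>A $ i \<bullet> x\<bar>) UNIV"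
    by (simp add: norm_vec_def matrix_vector_mul_component)
  also have "\<dots> \<le> L2_set (\<lambda>i. norm (A $ i) * norm x) UNIV"
    by (intro L2_set_mono Cauchy_Schwarz_ineq2) auto
  also have "\<dots> = norm A * norm x"
    by (simp add: norm_vec_def[of A] L2_set_left_distrib)
  finally show ?thesis .
qed

lemma bounded_bilinear_matrix_vector_mult:
  "bounded_bilinear ((*v) :: real^'n::finite^'m::finite \<Rightarrow> real^'n \<Rightarrow> real^'m)"
proof
  show "\<exists>K. \<forall>(A :: real^'n^'m) x. norm (A *v x) \<le> norm A * norm x * K"
    by (intro exI[of _ 1]) (simp add: norm_matrix_vector_mult_le)
qed (simp_all add: matrix_vector_mult_add_rdistrib matrix_vector_right_distrib matrix_vector_mult_scaleR
    scaleR_matrix_vector_assoc)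

lemma set_integrable_bounded:
  fixes f :: "real \<Rightarrow> 'b::{banach, second_countable_topology}"
  assumes "set_borel_measurable lborel {a..b} f" "\<And>x. x \<in> {a..b} \<Longrightarrow> norm (f x) \<le> B"
  shows "set_integrable lborel {a..b} f"
proof -
  \<comment> \<open>The inner indicator makes the integrand measurable on the whole line;
    \<open>f\<close> is only known to be measurable on the interval.\<close>
  have "integrable lborel (\<lambda>x. indicator {a..b} x *\<^sub>R (indicator {a..b} x *\<^sub>R f x))"
    using assms unfolding set_borel_measurable_def
    by (intro integrableI_bounded_set_indicator[where B = B]) (auto simp: emeasure_lborel_Icc_eq)
  then show ?thesis
    by (simp add: set_integrable_def indicator_inter_arith[symmetric])
qed

lemma set_borel_measurable_matrix_vector_mult:
  fixes A :: "'a \<Rightarrow> real^'n::finite^'m::finite"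
  assumes "set_borel_measurable M S A" "set_borel_measurable M S x"
  shows "set_borel_measurable M S (\<lambda>u. A u *v x u)"
proof -
  have "continuous_on UNIV (\<lambda>p :: (real^'n^'m) \<times> (real^'n). fst p *v snd p)"
    by (intro bounded_bilinear.continuous_on[OF bounded_bilinear_matrix_vector_mult] continuous_intros)
  from borel_measurable_continuous_Pair[OF assms[unfolded set_borel_measurable_def] this]
  have "(\<lambda>u. (indicator S u *\<^sub>R A u) *v (indicator S u *\<^sub>R x u)) \<in> borel_measurable M" .
  also have "(\<lambda>u. (indicator S u *\<^sub>R A u) *v (indicator S u *\<^sub>R x u)) =
      (\<lambda>u. indicator S u *\<^sub>R (A u *v x u))"
    by (auto simp: indicator_def fun_eq_iff)
  finally show ?thesis
    unfolding set_borel_measurable_def .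
qed

lemma norm_integral_le:
  fixes f :: "real \<Rightarrow> 'b::euclidean_space"
  assumes "f integrable_on {a..b}" "a \<le> b" "\<And>x. x \<in> {a..b} \<Longrightarrow> norm (f x) \<le> B"
  shows "norm (integral {a..b} f) \<le> B * (b - a)"
proof -
  have "0 \<le> B"
    using assms(2) assms(3)[of a] order_trans[OF norm_ge_zero] by simp
  with assms show ?thesis
    using has_integral_bound_real[of B "{}" f "integral {a..b} f" a b] by (auto simp: integrable_integral)
qed

text \<open>Each entry of a stochastic matrix lies between 0 and 1, and the crude constant counts
  the entries. What matters is uniformity in \<open>s\<close> and \<open>u\<close>.\<close>

lemma (in markov_jump_process) norm_P_le_card:
  assumes "0 \<le> s" "s \<le> u"
  shows "norm (P s u) \<le> real CARD('s) * real CARD('s)"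
proof -
  have nonneg: "0 \<le> P s u $ x $ y" and row: "(\<Sum>y\<in>UNIV. P s u $ x $ y) = 1" for x y
    using stochastic_P[OF assms] by (auto simp: stochastic_matrix_def)
  have "P s u $ x $ y \<le> 1" for x y
    using member_le_sum[of y UNIV "\<lambda>y. P s u $ x $ y"] nonneg row by simp
  with nonneg have "(\<Sum>x\<in>UNIV. \<Sum>y\<in>UNIV. \<bar>P s u $ x $ y\<bar>) \<le> (\<Sum>x\<in>(UNIV :: 's set). \<Sum>y\<in>(UNIV :: 's set). 1)"
    by (intro sum_mono) simp
  with norm_matrix_le_sum[of "P s u"] show ?thesis
    by simp
qed

section \<open>Means of lump-sum rewards; measurability and boundedness of the rates\<close>

text \<open>\<open>F c = 1\<close> puts all mass on \<open>{..c}\<close>, and the mean integrates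
  over \<open>{0..}\<close> only, so the integrand is almost surely between 0 and
  \<bar>c\<bar>.\<close>

lemma mean_of_df_bound:
  assumes F: "distribution_function F" and c: "F c = 1"
  shows "\<bar>mean_of_df F\<bar> \<le> \<bar>c\<bar>"
proof -
  have mono: "\<And>x y. x \<le> y \<Longrightarrow> F x \<le> F y" and cont: "\<And>a. continuous (at_right a) F"
    and bot: "(F \<longlongrightarrow> 0) at_bot" and top: "(F \<longlongrightarrow> 1) at_top"
    using F by (auto simp: distribution_function_def mono_def)
  interpret real_distribution "interval_measure F"
    using mono cont bot top by (rule real_distribution_interval_measure)
  have "prob {..c} = 1"
    using measure_interval_measure_Iic[of F c] mono cont bot c by simp
  then have "AE z in interval_measure F. z \<in> {..c}"
    by (intro prob_eq_1[THEN iffD1]) auto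
  then have "AE z in interval_measure F. 0 \<le> indicator {0..} z *\<^sub>R z \<and> indicator {0..} z *\<^sub>R z \<le> \<bar>c\<bar>"
    by eventually_elim (auto simp: indicator_def)
  then have AE: "AE z in interval_measure F. 0 \<le> indicator {0..} z *\<^sub>R z"
      "AE z in interval_measure F. indicator {0..} z *\<^sub>R z \<le> \<bar>c\<bar>"
    by auto
  then have int: "integrable (interval_measure F) (\<lambda>z. indicator {0..} z *\<^sub>R z)"
    by (intro integrable_const_bound[where B = "\<bar>c\<bar>"]) auto
  show ?thesis
    using integral_ge_const[OF int AE(1)] integral_le_const[OF int AE(2)]
    by (simp add: mean_of_df_def set_lebesgue_integral_def)
qed

text \<open>The half-lines \<open>{..a}\<close> form an intersection-stable generator of the Borel
  sets, so measurability of \<open>F t a\<close> in \<open>t\<close> makes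
  \<open>interval_measure (F t)\<close> a probability kernel. Integrating a fixed function against a
  kernel is measurable.\<close>

lemma mean_of_df_measurable:
  assumes df: "\<And>t. t \<in> space N \<Longrightarrow> distribution_function (F t)"
    and meas: "\<And>z. (\<lambda>t. F t z) \<in> borel_measurable N"
  shows "(\<lambda>t. mean_of_df (F t)) \<in> borel_measurable N"
proof -
  have mono: "x \<le> y \<Longrightarrow> F t x \<le> F t y" and cont: "continuous (at_right a) (F t)"
    and bot: "(F t \<longlongrightarrow> 0) at_bot" and top: "(F t \<longlongrightarrow> 1) at_top" if "t \<in> space N" for t x y a
    using df[OF that] by (auto simp: distribution_function_def mono_def)
  have rd: "real_distribution (interval_measure (F t))" if "t \<in> space N" for t
    using mono cont bot top that by (intro real_distribution_interval_measure)
  have "(\<lambda>t. interval_measure (F t)) \<in> measurable N (prob_algebra borel)"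
  proof (rule measurable_prob_algebra_generated)
    show "sets borel = sigma_sets UNIV (range (\<lambda>a::real. {..a}))"
      by (simp add: borel_eq_atMost)
    show "Int_stable (range (\<lambda>a::real. {..a}))"
      by (auto simp: Int_stable_def)
  next
    fix A :: "real set" assume "A \<in> range atMost"
    then obtain a where A: "A = {..a}" by auto
    have "emeasure (interval_measure (F t)) A = ennreal (F t a)" if "t \<in> space N" for t
      unfolding A using emeasure_interval_measure_Iic[of "F t" a] mono cont bot that by simp
    then show "(\<lambda>t. emeasure (interval_measure (F t)) A) \<in> borel_measurable N"
      using meas[of a] by (subst measurable_cong) auto
  qed (use rd in \<open>auto simp: real_distribution_def\<close>)
  then have "(\<lambda>t. interval_measure (F t)) \<in> measurable N (subprob_algebra borel)"
    by (rule measurable_prob_algebraD)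
  then have "(\<lambda>t. LINT z|interval_measure (F t). indicator {0..} z *\<^sub>R z) \<in> borel_measurable N"
    by (rule measurable_compose) measurable
  then show ?thesis
    by (simp add: mean_of_df_def set_lebesgue_integral_def)
qed

lemma borel_measurable_vec:
  fixes f :: "'a \<Rightarrow> 'b::euclidean_space^'n::finite"
  assumes "\<And>i. (\<lambda>x. f x $ i) \<in> borel_measurable N"
  shows "f \<in> borel_measurable N"
  using assms by (subst borel_measurable_euclidean_space) (auto simp: Basis_vec_def inner_axis)

lemma set_borel_measurable_nonneg_reals_iff:
  fixes f :: "real \<Rightarrow> 'b::real_normed_vector"
  shows "set_borel_measurable lborel {0..} f \<longleftrightarrow> f \<in> borel_measurable (restrict_space borel {0..})"
  by (simp add: set_borel_measurable_def borel_measurable_restrict_space_iff)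

lemma bounded_mult_comp:
  fixes f g :: "'a \<Rightarrow> real"
  assumes "bounded (f ` S)" "bounded (g ` S)"
  shows "bounded ((\<lambda>x. f x * g x) ` S)"
proof -
  obtain a b where "\<And>x. x \<in> S \<Longrightarrow> \<bar>f x\<bar> \<le> a" "\<And>x. x \<in> S \<Longrightarrow> \<bar>g x\<bar> \<le> b"
    using assms unfolding bounded_iff by auto
  then have "\<bar>f x * g x\<bar> \<le> a * b" if "x \<in> S" for x
    using that unfolding abs_mult by (intro mult_mono) (auto intro: order_trans[OF abs_ge_zero])
  then show ?thesis
    unfolding bounded_iff by auto
qed

lemma bounded_sum_comp:
  fixes f :: "'i \<Rightarrow> 'a \<Rightarrow> 'b::real_normed_vector"
  assumes "finite I" "\<And>i. i \<in> I \<Longrightarrow> bounded (f i ` S)"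
  shows "bounded ((\<lambda>x. \<Sum>i\<in>I. f i x) ` S)"
  using assms
proof (induction rule: finite_induct)
  case empty
  show ?case by (auto simp: bounded_iff)
next
  case (insert i I)
  then show ?case by (simp add: bounded_plus_comp)
qed

lemma bounded_vec:
  fixes f :: "'a \<Rightarrow> 'b::real_normed_vector^'n::finite"
  assumes "\<And>i. bounded ((\<lambda>x. f x $ i) ` S)"
  shows "bounded (f ` S)"
proof -
  obtain c where c: "\<And>i x. x \<in> S \<Longrightarrow> norm (f x $ i) \<le> c i"
    using assms unfolding bounded_iff by (metis imageI)
  have "norm (f x) \<le> (\<Sum>i\<in>UNIV. c i)" if "x \<in> S" for x
  proof -
    have "norm (f x) \<le> (\<Sum>i\<in>UNIV. norm (f x $ i))"
      by (simp add: norm_vec_def L2_set_le_sum)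
    also have "\<dots> \<le> (\<Sum>i\<in>UNIV. c i)"
      by (intro sum_mono c that)
    finally show ?thesis .
  qed
  then show ?thesis
    unfolding bounded_iff by auto
qed

lemma bounded_real_SUP:
  fixes f :: "'a \<Rightarrow> real"
  assumes "\<And>x. x \<in> S \<Longrightarrow> 0 \<le> f x" "(SUP x\<in>S. ereal (f x)) < \<infinity>"
  shows "bounded (f ` S)"
proof -
  obtain n :: nat where n: "(SUP x\<in>S. ereal (f x)) < ereal (real n)"
    using assms(2) less_PInf_Ex_of_nat by auto
  have "f x \<le> real n" if "x \<in> S" for x
    using SUP_upper[of x S "\<lambda>x. ereal (f x)"] that n by (metis ereal_less_eq(3) less_imp_le order_trans)
  with assms(1) show ?thesis
    unfolding bounded_iff by auto
qed

text \<open>Off the diagonal, a pair in \<open>positive_rates (Q 1)\<close> is bounded by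
  \<open>A3\<close>, and any other pair has rate zero at all times by \<open>A2\<close>. A diagonal
  entry is minus the sum of the rest of its row.\<close>

lemma bounded_rate_entries:
  assumes rate: "\<And>u. 0 \<le> u \<Longrightarrow> rate_matrix (Q u)" and "A2 Q" "A3 Q"
  shows "bounded ((\<lambda>u. Q u $ x $ y) ` {0..})"
proof -
  have off: "bounded ((\<lambda>u. Q u $ x $ y) ` {0..})" if "x \<noteq> y" for x y
  proof -
    have nonneg: "0 \<le> Q u $ x $ y" if "u \<in> {0..}" for u
      using rate[of u] that \<open>x \<noteq> y\<close> by (auto simp: rate_matrix_def)
    show ?thesis
    proof (cases "(x, y) \<in> positive_rates (Q 1)")
      case True
      with \<open>A3 Q\<close> nonneg show ?thesis
        by (intro bounded_real_SUP) (auto simp: A3_def)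
    next
      case False
      have "Q u $ x $ y = 0" if u: "u \<in> {0..}" for u
      proof -
        have "positive_rates (Q u) = positive_rates (Q 1)"
          using \<open>A2 Q\<close> u unfolding A2_def by (metis atLeast_iff zero_le_one)
        with False nonneg[OF u] show ?thesis
          by (auto simp: positive_rates_def)
      qed
      then show ?thesis
        unfolding bounded_iff by auto
    qed
  qed
  show ?thesis
  proof (cases "x = y")
    case True
    have eq: "Q u $ x $ x = (\<Sum>y\<in>UNIV - {x}. - Q u $ x $ y)" if "u \<in> {0..}" for u
      using rate[of u] that sum.remove[of UNIV x "\<lambda>y. Q u $ x $ y"]
      by (auto simp: rate_matrix_def sum_negf)
    have "bounded ((\<lambda>u. \<Sum>y\<in>UNIV - {x}. - Q u $ x $ y) ` {0..})"
      using off by (intro bounded_sum_comp) (auto simp: bounded_minus_comp)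
    then have "bounded ((\<lambda>u. Q u $ x $ x) ` {0..})"
      by (subst image_cong[OF refl eq])
    with True show ?thesis by simp
  qed (rule off)
qed

lemma distribution_function_le_1:
  assumes "distribution_function F"
  shows "F z \<le> 1"
proof (rule tendsto_lowerbound)
  show "(F \<longlongrightarrow> 1) at_top" "\<forall>\<^sub>F x in at_top. F z \<le> F x"
    using assms by (auto simp: distribution_function_def mono_def eventually_at_top_linorder)
qed simp

text \<open>An infimum of 1 together with \<open>F t c \<le> 1\<close> forces
  \<open>F t c = 1\<close> at every time, and \<open>c\<close> does not depend on
  \<open>t\<close>.\<close>

lemma bounded_mean_of_df:
  assumes df: "\<And>t. 0 \<le> t \<Longrightarrow> distribution_function (F t)"
    and inf: "(INF t\<in>{0..}. ereal (F t c)) = 1"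
  shows "bounded ((\<lambda>t. mean_of_df (F t)) ` {0..})"
proof -
  have "F t c = 1" if "t \<in> {0..}" for t
  proof -
    have "1 \<le> ereal (F t c)"
      using INF_lower[OF that, of "\<lambda>t. ereal (F t c)"] inf by simp
    with distribution_function_le_1[of "F t" c] df[of t] that show ?thesis
      by (simp add: one_ereal_def)
  qed
  then have "\<bar>mean_of_df (F t)\<bar> \<le> \<bar>c\<bar>" if "t \<in> {0..}" for t
    using df mean_of_df_bound that by auto
  then show ?thesis
    unfolding bounded_iff by auto
qed

text \<open>The index set in \<open>gamma1\<close> varies with \<open>t\<close>. Truncating the
  rates at zero gives a sum over a fixed index set, to which closure under finite sums
  applies.\<close>

lemma gamma1_eq: "gamma1 Q G t x = (\<Sum>y\<in>UNIV. max 0 (Q t $ x $ y) * mean_of_df (G t x y))"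
  unfolding gamma1_def positive_rates_def by (rule sum.mono_neutral_cong_left) auto

lemma bounded_r_tilde:
  assumes rate: "\<And>u. 0 \<le> u \<Longrightarrow> rate_matrix (Q u)"
    and dfG: "\<And>t x y. 0 \<le> t \<Longrightarrow> distribution_function (G t x y)"
    and dfK: "\<And>t x. 0 \<le> t \<Longrightarrow> distribution_function (K t x)"
    and "A2 Q" "A3 Q" "A4 Q r \<beta> G H K"
  shows "bounded (r_tilde Q r \<beta> G K ` {0..})"
proof -
  obtain c where c: "0 \<le> (INF t\<in>{0..}. ereal (r t x))" "(SUP t\<in>{0..}. ereal (r t x)) < \<infinity>"
      "0 \<le> (INF t\<in>{0..}. ereal (\<beta> t x))" "(SUP t\<in>{0..}. ereal (\<beta> t x)) < \<infinity>"
      "(INF t\<in>{0..}. ereal (G t x y (c x))) = 1" "(INF t\<in>{0..}. ereal (K t x (c x))) = 1" for x y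
    using \<open>A4 Q r \<beta> G H K\<close> unfolding A4_def by blast
  have r: "bounded ((\<lambda>t. r t x) ` {0..})" and \<beta>: "bounded ((\<lambda>t. \<beta> t x) ` {0..})" for x
    using c(1-4)[of x] by (auto intro!: bounded_real_SUP simp: le_INF_iff)
  have Q: "bounded ((\<lambda>t. max 0 (Q t $ x $ y)) ` {0..})" for x y
    using bounded_rate_entries[OF rate \<open>A2 Q\<close> \<open>A3 Q\<close>, of x y]
    unfolding bounded_iff by (fastforce simp: max_def)
  have "bounded ((\<lambda>t. gamma1 Q G t x) ` {0..})" for x
    unfolding gamma1_eq
    by (intro bounded_sum_comp bounded_mult_comp Q bounded_mean_of_df[OF dfG c(5)]) auto
  moreover have "bounded ((\<lambda>t. gamma2 \<beta> K t x) ` {0..})" for x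
    unfolding gamma2_def by (intro bounded_mult_comp \<beta> bounded_mean_of_df[OF dfK c(6)])
  ultimately show ?thesis
    by (intro bounded_vec) (simp add: r_tilde_def gamma_rate_def bounded_plus_comp r)
qed

lemma r_tilde_measurable:
  assumes dfG: "\<And>t x y. 0 \<le> t \<Longrightarrow> distribution_function (G t x y)"
    and dfK: "\<And>t x. 0 \<le> t \<Longrightarrow> distribution_function (K t x)"
    and "A1 Q r \<beta> G K"
  shows "set_borel_measurable lborel {0..} (r_tilde Q r \<beta> G K)"
proof -
  let ?N = "restrict_space borel {0 :: real..}"
  have [measurable]: "(\<lambda>t. Q t $ x $ y) \<in> borel_measurable ?N" "(\<lambda>t. r t x) \<in> borel_measurable ?N"
      "(\<lambda>t. G t x y z) \<in> borel_measurable ?N" "(\<lambda>t. K t x z) \<in> borel_measurable ?N"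
      "(\<lambda>t. \<beta> t x) \<in> borel_measurable ?N" for x y z
    using \<open>A1 Q r \<beta> G K\<close> by (auto simp: A1_def)
  have [measurable]: "(\<lambda>t. mean_of_df (G t x y)) \<in> borel_measurable ?N"
      "(\<lambda>t. mean_of_df (K t x)) \<in> borel_measurable ?N" for x y
    by (auto intro!: mean_of_df_measurable dfG dfK simp: space_restrict_space)
  have "(\<lambda>t. r t x + (gamma1 Q G t x + gamma2 \<beta> K t x)) \<in> borel_measurable ?N" for x
    unfolding gamma1_eq gamma2_def by measurable
  then show ?thesis
    by (auto simp: set_borel_measurable_nonneg_reals_iff r_tilde_def gamma_rate_def intro!: borel_measurable_vec)
qed

section \<open>The truncated schedule, and passing from negligible sets to almost everywhere\<close>

text \<open>Strict growth is claimed only from entries before \<open>t\<close>: if \<open>t\<close>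
  is a scheduled time, it occurs in the last two places.\<close>

lemma truncated_schedule_properties:
  assumes T: "T 0 = 0" "strict_mono T" "filterlim T at_top sequentially" and "0 < t"
  shows "truncated_schedule T t 0 = 0"
    and "truncated_schedule T t (num_scheduled T t + 1) = t"
    and "\<And>i j. \<lbrakk>i \<le> j; j \<le> num_scheduled T t + 1\<rbrakk> \<Longrightarrow> truncated_schedule T t i \<le> truncated_schedule T t j"
    and "\<And>i j. \<lbrakk>i < j; j \<le> num_scheduled T t + 1; truncated_schedule T t i < t\<rbrakk> \<Longrightarrow>
          truncated_schedule T t i < truncated_schedule T t j"
proof -
  let ?S = "{i. T i \<le> t}" and ?k = "num_scheduled T t"
  obtain N where "\<And>i. N \<le> i \<Longrightarrow> t < T i"
    using T(3) by (auto simp: filterlim_at_top_dense eventually_sequentially)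
  then have "finite ?S"
    by (intro finite_subset[of ?S "{..<N}"]) (auto simp: not_le[symmetric])
  moreover have "0 \<in> ?S"
    using T(1) \<open>0 < t\<close> by simp
  ultimately have "Max ?S \<in> ?S"
    by (intro Max_in) auto
  \<comment> \<open>The supremum of a nonempty set of naturals is its \<open>Max\<close>;
    finiteness, from \<open>T\<close> being unbounded, makes it an element of the set.\<close>
  moreover have "?k = Max ?S"
    using \<open>0 \<in> ?S\<close> by (auto simp: num_scheduled_def Sup_nat_def)
  ultimately have "?k \<in> ?S"
    by simp
  then have le_t: "T i \<le> t" if "i \<le> ?k" for i
    using that strict_mono_less_eq[OF T(2)] by (auto intro: order_trans)
  show "truncated_schedule T t 0 = 0"
    by (simp add: truncated_schedule_def T(1))
  show "truncated_schedule T t (?k + 1) = t"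
    by (simp add: truncated_schedule_def)
  show "truncated_schedule T t i \<le> truncated_schedule T t j" if "i \<le> j" "j \<le> ?k + 1" for i j
    using that le_t strict_mono_less_eq[OF T(2)] by (auto simp: truncated_schedule_def)
  show "truncated_schedule T t i < truncated_schedule T t j"
    if "i < j" "j \<le> ?k + 1" "truncated_schedule T t i < t" for i j
    using that strict_mono_less[OF T(2)] by (auto simp: truncated_schedule_def split: if_splits)
qed

text \<open>\<open>N\<close> need not be Borel. Negligible sets are the null sets of the completed
  measure, and a measure and its completion agree on almost-everywhere statements.\<close>

lemma negligible_imp_AE_lborel:
  assumes "negligible N" "\<And>x. x \<notin> N \<Longrightarrow> R x"
  shows "AE x in lborel. R x"
proof -
  have "AE x in lebesgue. x \<notin> N"
    using assms(1) by (simp add: negligible_iff_null_sets AE_not_in)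
  then have "AE x in lborel. x \<notin> N"
    by (simp add: AE_completion_iff)
  then show ?thesis
    by eventually_elim (rule assms(2))
qed

section \<open>Consequences of the forward equation under uniform bounds\<close>

locale bounded_rates = markov_jump_process M X Q P
  for M :: "'w measure" and X :: "real \<Rightarrow> 'w \<Rightarrow> 's::finite"
    and Q :: "real \<Rightarrow> real^'s^'s" and P :: "real \<Rightarrow> real \<Rightarrow> real^'s^'s" +
  fixes B C :: real
  assumes Q_measurable: "set_borel_measurable lborel {0..} Q"
    and norm_Q_le: "\<And>u. 0 \<le> u \<Longrightarrow> norm (Q u) \<le> B"
    and norm_P_le: "\<And>s u. \<lbrakk>0 \<le> s; s \<le> u\<rbrakk> \<Longrightarrow> norm (P s u) \<le> C"
begin

lemma B_nonneg: "0 \<le> B"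
  using norm_Q_le[of 0] norm_ge_zero[of "Q 0"] by linarith

lemma C_nonneg: "0 \<le> C"
  using norm_P_le[of 0 0] norm_ge_zero[of "P 0 0"] by linarith

lemma norm_P_mult_le:
  assumes "0 \<le> s" "s \<le> u"
  shows "norm (P s u *v x) \<le> C * norm x"
  using norm_matrix_vector_mult_le[of "P s u" x] mult_right_mono[OF norm_P_le[OF assms], of "norm x"]
  by simp

lemma norm_Q_mult_le:
  assumes "0 \<le> u"
  shows "norm (Q u *v x) \<le> B * norm x"
  using norm_matrix_vector_mult_le[of "Q u" x] mult_right_mono[OF norm_Q_le[OF assms], of "norm x"]
  by simp

text \<open>Applying a matrix to a fixed vector is a bounded linear map of the matrix, hence
  commutes with the integral.\<close>

lemma forward_equation_vector:
  assumes "0 \<le> s" "s \<le> u"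
  shows "(\<lambda>v. P s v *v (Q v *v x)) integrable_on {s..u}"
    and "P s u *v x = x + integral {s..u} (\<lambda>v. P s v *v (Q v *v x))"
proof -
  have lin: "bounded_linear (\<lambda>A :: real^'s^'s. A *v x)"
    by (rule bounded_bilinear.bounded_linear_left[OF bounded_bilinear_matrix_vector_mult])
  note int = set_borel_integral_eq_integral[OF forward_integrable[OF assms]]
  show "(\<lambda>v. P s v *v (Q v *v x)) integrable_on {s..u}"
    using integrable_linear[OF int(1) lin] by (simp add: o_def matrix_vector_mul_assoc)
  show "P s u *v x = x + integral {s..u} (\<lambda>v. P s v *v (Q v *v x))"
    using integral_linear[OF int(1) lin] forward_equation[OF assms]
    by (simp add: int(2) o_def matrix_vector_mul_assoc matrix_vector_mult_add_rdistrib)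
qed

text \<open>The integrand of the forward equation is at most \<open>C * B * norm x\<close>. This is
  the uniform estimate that allows \<open>P s u\<close> to be replaced by the identity over short
  times.\<close>

lemma norm_P_diff_le:
  assumes "0 \<le> s" "s \<le> u"
  shows "norm (P s u *v x - x) \<le> C * B * norm x * (u - s)"
proof -
  have "norm (P s v *v (Q v *v x)) \<le> C * B * norm x" if "v \<in> {s..u}" for v
  proof -
    have "norm (P s v *v (Q v *v x)) \<le> C * norm (Q v *v x)"
      using norm_P_mult_le[of s v "Q v *v x"] assms that by simp
    also have "\<dots> \<le> C * (B * norm x)"
      using assms that C_nonneg by (intro mult_left_mono norm_Q_mult_le) auto
    finally show ?thesis by (simp add: mult.assoc)
  qed
  with norm_integral_le[OF forward_equation_vector(1)[OF assms] \<open>s \<le> u\<close>] show ?thesis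
    by (simp add: forward_equation_vector(2)[OF assms])
qed

text \<open>By the forward equation \<open>P s\<close> is an indefinite integral. Continuity serves
  to make \<open>P s u *v f u\<close> measurable in \<open>u\<close>.\<close>

lemma continuous_on_P:
  assumes "0 \<le> s" "s \<le> b"
  shows "continuous_on {s..b} (P s)"
proof -
  have "continuous_on {s..b} (\<lambda>u. mat 1 + integral {s..u} (\<lambda>v. P s v ** Q v))"
    using set_borel_integral_eq_integral(1)[OF forward_integrable[OF assms]]
    by (intro continuous_intros indefinite_integral_continuous_1)
  then show ?thesis
    using forward_equation set_borel_integral_eq_integral(2)[OF forward_integrable] assms
    by (auto elim!: continuous_on_eq)
qed

lemma P_mult_integrable:
  assumes "0 \<le> s" "s \<le> b" "set_borel_measurable lborel {s..b} f"
    and "\<And>u. u \<in> {s..b} \<Longrightarrow> norm (f u) \<le> D"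
  shows "set_integrable lborel {s..b} (\<lambda>u. P s u *v f u)"
proof (rule set_integrable_bounded)
  have "set_borel_measurable lborel {s..b} (P s)"
    using borel_measurable_continuous_on_indicator[OF _ continuous_on_P[OF assms(1,2)]]
    by (simp add: set_borel_measurable_def)
  with assms(3) show "set_borel_measurable lborel {s..b} (\<lambda>u. P s u *v f u)"
    by (intro set_borel_measurable_matrix_vector_mult)
  show "norm (P s u *v f u) \<le> C * D" if "u \<in> {s..b}" for u
    using norm_P_mult_le[of s u "f u"] mult_left_mono[OF assms(4)[OF that] C_nonneg] assms(1) that
    by simp
qed

lemma Q_mult_integrable:
  assumes "0 \<le> s" "continuous_on {s..b} f"
  shows "set_integrable lborel {s..b} (\<lambda>u. Q u *v f u)"
proof -
  have "bounded (f ` {s..b})"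
    using assms(2) by (intro compact_imp_bounded compact_continuous_image) auto
  then obtain D where D: "\<And>u. u \<in> {s..b} \<Longrightarrow> norm (f u) \<le> D"
    unfolding bounded_iff by blast
  show ?thesis
  proof (rule set_integrable_bounded)
    have "set_borel_measurable lborel {s..b} f"
      using borel_measurable_continuous_on_indicator[OF _ assms(2)]
      by (simp add: set_borel_measurable_def)
    moreover have "set_borel_measurable lborel {s..b} Q"
      using \<open>0 \<le> s\<close> by (intro set_borel_measurable_subset[OF Q_measurable]) auto
    ultimately show "set_borel_measurable lborel {s..b} (\<lambda>u. Q u *v f u)"
      by (intro set_borel_measurable_matrix_vector_mult)
    show "norm (Q u *v f u) \<le> B * D" if "u \<in> {s..b}" for u
      using norm_Q_mult_le[of u "f u"] mult_left_mono[OF D[OF that] B_nonneg] assms(1) that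
      by simp
  qed
qed

section \<open>Functions satisfying the cocycle identity on a closed interval\<close>

context
  fixes a b D :: real and f g :: "real \<Rightarrow> real^'s"
  assumes ab: "0 \<le> a" "a \<le> b"
    and f_measurable: "set_borel_measurable lborel {a..b} f"
    and f_bound: "\<And>u. u \<in> {a..b} \<Longrightarrow> norm (f u) \<le> D"
    and cocycle: "\<And>s s'. \<lbrakk>a \<le> s; s \<le> s'; s' \<le> b\<rbrakk> \<Longrightarrow>
          g s = integral {s..s'} (\<lambda>u. P s u *v f u) + P s s' *v g s'"
begin

text \<open>The cocycle identity with \<open>s' = b\<close> bounds \<open>g\<close> by
  \<open>gmax\<close>: reward accumulated over a time of at most \<open>b - a\<close>, plus the
  transported end value.\<close>

abbreviation (input) "gmax \<equiv> C * D * (b - a) + C * norm (g b)"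
text \<open>A Lipschitz constant of \<open>g\<close>: \<open>C * D\<close> comes from the reward
  accumulated between two times, the rest from replacing \<open>P s s'\<close> by the identity in
  front of \<open>g s'\<close>.\<close>

abbreviation (input) "lip \<equiv> C * D + C * B * gmax"

private lemma D_nonneg: "0 \<le> D"
  using f_bound[of a] ab order_trans[OF norm_ge_zero] by simp

private lemma Pf:
  assumes "a \<le> s" "s \<le> s'" "s' \<le> b"
  shows "(\<lambda>u. P s u *v f u) integrable_on {s..s'}"
    and "norm (integral {s..s'} (\<lambda>u. P s u *v f u)) \<le> C * D * (s' - s)"
proof -
  have "set_borel_measurable lborel {s..s'} f"
    using assms by (intro set_borel_measurable_subset[OF f_measurable]) auto
  then show "(\<lambda>u. P s u *v f u) integrable_on {s..s'}"
    using ab assms f_bound by (intro set_borel_integral_eq_integral(1) P_mult_integrable[where D = D]) auto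
  then show "norm (integral {s..s'} (\<lambda>u. P s u *v f u)) \<le> C * D * (s' - s)"
  proof (rule norm_integral_le[OF _ \<open>s \<le> s'\<close>])
    fix u assume "u \<in> {s..s'}"
    then show "norm (P s u *v f u) \<le> C * D"
      using norm_P_mult_le[of s u "f u"] mult_left_mono[OF f_bound[of u] C_nonneg] ab assms by simp
  qed
qed

private lemma g_bound:
  assumes "s \<in> {a..b}"
  shows "norm (g s) \<le> gmax"
proof -
  have "norm (g s) \<le> C * D * (b - s) + C * norm (g b)"
    using cocycle[of s b] Pf(2)[of s b] norm_P_mult_le[of s b "g b"] ab assms
    by (auto intro!: order_trans[OF norm_triangle_ineq] add_mono)
  also have "\<dots> \<le> gmax"
    using assms C_nonneg D_nonneg by (intro add_right_mono mult_left_mono) auto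
  finally show ?thesis .
qed

private lemma gmax_nonneg: "0 \<le> gmax"
  using g_bound[of a] ab norm_ge_zero[of "g a"] by (metis atLeastAtMost_iff order.refl order_trans)

lemma cocycle_lipschitz:
  assumes "a \<le> s" "s \<le> s'" "s' \<le> b"
  shows "norm (g s - g s') \<le> lip * (s' - s)"
proof -
  have "g s - g s' = integral {s..s'} (\<lambda>u. P s u *v f u) + (P s s' *v g s' - g s')"
    using cocycle[OF assms] by simp
  also have "norm \<dots> \<le> C * D * (s' - s) + C * B * norm (g s') * (s' - s)"
    using ab assms by (intro order_trans[OF norm_triangle_ineq] add_mono Pf norm_P_diff_le) auto
  also have "\<dots> \<le> C * D * (s' - s) + C * B * gmax * (s' - s)"
    using assms B_nonneg C_nonneg by (intro add_left_mono mult_right_mono mult_left_mono g_bound) auto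
  finally show ?thesis by (simp add: algebra_simps)
qed

lemma cocycle_continuous: "continuous_on {a..b} g"
proof (rule lipschitz_on_continuous_on)
  show "lip-lipschitz_on {a..b} g"
  proof (rule lipschitz_onI)
    fix x y assume "x \<in> {a..b}" "y \<in> {a..b}"
    then show "dist (g x) (g y) \<le> lip * dist x y"
      using cocycle_lipschitz[of x y] cocycle_lipschitz[of y x]
      by (cases "x \<le> y") (auto simp: dist_norm norm_minus_commute)
  qed (use D_nonneg B_nonneg C_nonneg gmax_nonneg in auto)
qed

lemma cocycle_integrable:
  assumes "a \<le> s" "s' \<le> b"
  shows "f integrable_on {s..s'}" "(\<lambda>u. Q u *v g u) integrable_on {s..s'}"
proof -
  show "f integrable_on {s..s'}"
    using set_integrable_bounded[OF f_measurable f_bound] assms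
    by (auto intro: integrable_on_subinterval dest: set_borel_integral_eq_integral(1))
  show "(\<lambda>u. Q u *v g u) integrable_on {s..s'}"
    using ab assms
    by (intro set_borel_integral_eq_integral(1) Q_mult_integrable continuous_on_subset[OF cocycle_continuous]) auto
qed

text \<open>
  Replacing \<open>P s u\<close> by \<open>1\<close> and \<open>g s'\<close> by \<open>g u\<close> costs \<open>O(s' - s)\<close> in the integrand, so the
  difference of the two sides of the backward equation has quadratically small increments.
\<close>

lemma cocycle_backward_equation:
  assumes s: "s \<in> {a..b}"
  shows "g s = integral {s..b} (\<lambda>u. f u + Q u *v g u) + g b"
proof -
  define F where "F = (\<lambda>s. g s - integral {s..b} (\<lambda>u. f u + Q u *v g u))"
  \<comment> \<open>The summands are the constants of the estimates \<open>1\<close>,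
    \<open>2\<close> and \<open>3\<close> below: \<open>P x u\<close> replaced by the identity in
    front of \<open>f u\<close>, the same in front of \<open>Q u *v g y\<close>, and
    \<open>g y\<close> replaced by \<open>g u\<close>.\<close>
  define K where "K = C * B * D + C * B * (B * gmax) + B * lip"
  have fQg: "(\<lambda>u. f u + Q u *v g u) integrable_on {s..s'}" if "a \<le> s" "s' \<le> b" for s s'
    using cocycle_integrable[OF that] by (rule integrable_add)
  have lip_nonneg: "0 \<le> lip"
    using D_nonneg B_nonneg C_nonneg gmax_nonneg by simp
  have "norm (F x - F y) \<le> K * (y - x)\<^sup>2" if xy: "x \<in> {a..b}" "y \<in> {a..b}" "x \<le> y" for x y
  proof -
    have x: "0 \<le> x" "a \<le> x" "y \<le> b" using ab xy by auto
    note Pf = Pf[OF x(2) \<open>x \<le> y\<close> x(3)]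
    \<comment> \<open>For the fixed vector \<open>g y\<close> the forward equation writes
      \<open>P x y *v g y - g y\<close> as an integral over \<open>{x..y}\<close>. The whole
      increment of \<open>F\<close> is then the integral of \<open>?i\<close>; a bound
      \<open>K * (y - x)\<close> on \<open>?i\<close> gains the second factor from the length of the
      interval.\<close>
    note PQg = forward_equation_vector[OF x(1) \<open>x \<le> y\<close>, of "g y"]
    let ?i = "\<lambda>u. (P x u *v f u + P x u *v (Q u *v g y)) - (f u + Q u *v g u)"
    have i: "?i integrable_on {x..y}"
      by (intro integrable_diff integrable_add[OF Pf(1) PQg(1)] fQg x)
    have "integral {x..b} (\<lambda>u. f u + Q u *v g u) =
        integral {x..y} (\<lambda>u. f u + Q u *v g u) + integral {y..b} (\<lambda>u. f u + Q u *v g u)"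
      using x xy by (intro Henstock_Kurzweil_Integration.integral_combine[symmetric] fQg) auto
    then have "F x - F y = (g x - g y) - integral {x..y} (\<lambda>u. f u + Q u *v g u)"
      by (simp add: F_def)
    also have "g x - g y = integral {x..y} (\<lambda>u. P x u *v f u) +
        integral {x..y} (\<lambda>u. P x u *v (Q u *v g y))"
      using cocycle[OF x(2) \<open>x \<le> y\<close> x(3)] PQg(2) by simp
    finally have "F x - F y = integral {x..y} ?i"
      using Pf(1) PQg(1) fQg[OF x(2,3)]
      by (simp only: integral_diff integral_add integrable_add)
    also have "norm \<dots> \<le> K * (y - x) * (y - x)"
    proof (rule norm_integral_le[OF i \<open>x \<le> y\<close>])
      fix u assume u: "u \<in> {x..y}"
      have u': "0 \<le> u" "u \<in> {a..b}" using u x by auto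
      have 1: "norm (P x u *v f u - f u) \<le> C * B * D * (y - x)"
      proof -
        have "norm (P x u *v f u - f u) \<le> C * B * norm (f u) * (u - x)"
          using x u by (intro norm_P_diff_le) auto
        also have "\<dots> \<le> C * B * D * (y - x)"
          using f_bound[OF u'(2)] u B_nonneg C_nonneg D_nonneg by (intro mult_mono) auto
        finally show ?thesis .
      qed
      have 2: "norm (P x u *v (Q u *v g y) - Q u *v g y) \<le> C * B * (B * gmax) * (y - x)"
      proof -
        have "norm (Q u *v g y) \<le> B * norm (g y)"
          using u' by (intro norm_Q_mult_le)
        also have "\<dots> \<le> B * gmax"
          using B_nonneg xy by (intro mult_left_mono g_bound)
        finally have Qg: "norm (Q u *v g y) \<le> B * gmax" .
        have "norm (P x u *v (Q u *v g y) - Q u *v g y) \<le> C * B * norm (Q u *v g y) * (u - x)"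
          using x u by (intro norm_P_diff_le) auto
        also have "\<dots> \<le> C * B * (B * gmax) * (y - x)"
          using Qg u B_nonneg C_nonneg gmax_nonneg by (intro mult_mono) auto
        finally show ?thesis .
      qed
      have 3: "norm (Q u *v (g y - g u)) \<le> B * lip * (y - x)"
      proof -
        have "norm (g u - g y) \<le> lip * (y - u)"
          using u x by (intro cocycle_lipschitz) auto
        also have "\<dots> \<le> lip * (y - x)"
          using lip_nonneg u by (intro mult_left_mono) auto
        finally have "B * norm (g y - g u) \<le> B * (lip * (y - x))"
          using B_nonneg by (intro mult_left_mono) (simp_all add: norm_minus_commute)
        with norm_Q_mult_le[OF u'(1), of "g y - g u"] show ?thesis
          by (simp add: mult.assoc)
      qed
      have "?i u = (P x u *v f u - f u) + (P x u *v (Q u *v g y) - Q u *v g y) + Q u *v (g y - g u)"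
        by (simp add: matrix_vector_mult_diff_distrib)
      also have "norm \<dots> \<le> C * B * D * (y - x) + C * B * (B * gmax) * (y - x) + B * lip * (y - x)"
        using 1 2 3 by (intro order_trans[OF norm_triangle_ineq] add_mono)
      also have "\<dots> = K * (y - x)"
        by (simp add: K_def algebra_simps)
      finally show "norm (?i u) \<le> K * (y - x)" .
    qed
    finally show ?thesis
      by (simp add: power2_eq_square mult.assoc)
  qed
  \<comment> \<open>At \<open>b\<close> the integral is over a single point, so
    \<open>F b = g b\<close>.\<close>
  then have "F s = F b"
    using s ab by (intro quadratic_increments_imp_constant[of "{a..b}"]) auto
  then show ?thesis
    by (simp add: F_def algebra_simps)
qed

lemma cocycle_backward_equation_lebesgue:
  assumes s: "s \<in> {a..b}"
  shows "g s = (LINT u:{s..b}|lborel. f u) + (LINT u:{s..b}|lborel. Q u *v g u) + g b"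
proof -
  have "set_borel_measurable lborel {s..b} f"
    using s by (intro set_borel_measurable_subset[OF f_measurable]) auto
  then have f: "set_integrable lborel {s..b} f"
    using s f_bound by (intro set_integrable_bounded[where B = D]) auto
  have Qg: "set_integrable lborel {s..b} (\<lambda>u. Q u *v g u)"
    using cocycle_continuous s ab
    by (intro Q_mult_integrable) (auto intro: continuous_on_subset)
  show ?thesis
    using cocycle_backward_equation[OF s]
      set_borel_integral_eq_integral[OF f] set_borel_integral_eq_integral[OF Qg]
    by (simp add: integral_add)
qed

lemma cocycle_differentiable_ae:
  obtains N where "negligible N"
    and "\<And>s. \<lbrakk>s \<in> {a<..<b}; s \<notin> N\<rbrakk> \<Longrightarrow>
      (g has_vector_derivative - (f s + Q s *v g s)) (at s)"
proof -
  have "(\<lambda>u. f u + Q u *v g u) integrable_on {a..b}"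
    using cocycle_integrable[of a b] by (auto intro: integrable_add)
  from indefinite_integral_has_vector_derivative_ae[OF this]
  obtain N where N: "negligible N" "\<And>s. \<lbrakk>s \<in> {a<..<b}; s \<notin> N\<rbrakk> \<Longrightarrow>
      ((\<lambda>s. integral {s..b} (\<lambda>u. f u + Q u *v g u)) has_vector_derivative - (f s + Q s *v g s)) (at s)"
    by blast
  have "(g has_vector_derivative - (f s + Q s *v g s)) (at s)" if "s \<in> {a<..<b}" "s \<notin> N" for s
  proof (rule has_vector_derivative_transform_within_open)
    show "((\<lambda>s. integral {s..b} (\<lambda>u. f u + Q u *v g u) + g b) has_vector_derivative
        - (f s + Q s *v g s)) (at s)"
      using N(2)[OF that] by (auto intro!: derivative_eq_intros)
    show "integral {s..b} (\<lambda>u. f u + Q u *v g u) + g b = g s" if "s \<in> {a<..<b}" for s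
      using cocycle_backward_equation[of s] that by simp
  qed (use that in auto)
  with N(1) that show ?thesis by blast
qed

text \<open>Continuity on the closed interval includes the left end; this will provide the right
  limit of \<open>m\<close> at a scheduled time.\<close>

lemma cocycle_right_limit:
  assumes "a < b"
  shows "(g \<longlongrightarrow> g a) (at_right a)"
proof -
  have "(g \<longlongrightarrow> g a) (at a within {a..b})"
    using cocycle_continuous assms
    by (auto simp: continuous_on_def)
  then show ?thesis
    using assms by (simp add: at_within_Icc_at_right)
qed

end

section \<open>The mean reward along a schedule\<close>

text \<open>By Chapman-Kolmogorov the factor \<open>P s s'\<close> splits off from every
  \<open>P s u\<close> with \<open>s' \<le> u\<close> and passes through integral and sum by
  linearity. The index set \<open>J\<close> is the same on both sides, and the condition on it says
  that no lump sum falls before \<open>s'\<close>.\<close>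

lemma reward_cocycle:
  assumes s: "0 \<le> s" "s \<le> s'" "s' \<le> t" and J: "\<And>j. j \<in> J \<Longrightarrow> s' \<le> \<tau> j"
    and f_measurable: "set_borel_measurable lborel {s..t} f"
    and f_bound: "\<And>u. u \<in> {s..t} \<Longrightarrow> norm (f u) \<le> D"
  shows "integral {s..t} (\<lambda>u. P s u *v f u) + (\<Sum>j\<in>J. P s (\<tau> j) *v h (\<tau> j)) =
    integral {s..s'} (\<lambda>u. P s u *v f u) +
      P s s' *v (integral {s'..t} (\<lambda>u. P s' u *v f u) + (\<Sum>j\<in>J. P s' (\<tau> j) *v h (\<tau> j)))"
proof -
  have "set_borel_measurable lborel {s'..t} f"
    using s by (intro set_borel_measurable_subset[OF f_measurable]) auto
  then have int: "(\<lambda>u. P s u *v f u) integrable_on {s..t}" "(\<lambda>u. P s' u *v f u) integrable_on {s'..t}"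
    using s f_measurable f_bound
    by (auto intro!: set_borel_integral_eq_integral(1) P_mult_integrable[where D = D])
  have CK: "P s u *v x = P s s' *v (P s' u *v x)" if "s' \<le> u" for u x
    using Chapman_Kolmogorov[of s s' u] s that by (simp add: matrix_vector_mul_assoc)
  have "integral {s'..t} (\<lambda>u. P s u *v f u) = integral {s'..t} (\<lambda>u. P s s' *v (P s' u *v f u))"
    by (intro integral_cong CK) auto
  also have "\<dots> = P s s' *v integral {s'..t} (\<lambda>u. P s' u *v f u)"
    using integral_linear[OF int(2) matrix_vector_mul_bounded_linear] by (simp add: o_def)
  finally have "integral {s..t} (\<lambda>u. P s u *v f u) =
      integral {s..s'} (\<lambda>u. P s u *v f u) + P s s' *v integral {s'..t} (\<lambda>u. P s' u *v f u)"
    using Henstock_Kurzweil_Integration.integral_combine[OF s(2,3) int(1)] by simp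
  moreover have "(\<Sum>j\<in>J. P s (\<tau> j) *v h (\<tau> j)) = P s s' *v (\<Sum>j\<in>J. P s' (\<tau> j) *v h (\<tau> j))"
    unfolding linear_sum[OF matrix_vector_mul_linear] by (intro sum.cong refl CK J)
  ultimately show ?thesis
    by (simp add: matrix_vector_right_distrib)
qed

context
  fixes t D :: real and n :: nat and \<tau> :: "nat \<Rightarrow> real" and f h m :: "real \<Rightarrow> real^'s"
  assumes f_measurable: "set_borel_measurable lborel {0..} f"
    and f_bound: "\<And>u. 0 \<le> u \<Longrightarrow> norm (f u) \<le> D"
    and h_t: "h t = 0"
    and m: "m = mean_reward P f h \<tau> n t"
    and \<tau>_0: "\<tau> 0 = 0" and \<tau>_n: "\<tau> n = t"
    and \<tau>_mono: "\<And>i j. \<lbrakk>i \<le> j; j \<le> n\<rbrakk> \<Longrightarrow> \<tau> i \<le> \<tau> j"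
    and \<tau>_strict: "\<And>i j. \<lbrakk>i < j; j \<le> n; \<tau> i < t\<rbrakk> \<Longrightarrow> \<tau> i < \<tau> j"
begin

text \<open>
  \<open>reward_after b s\<close> omits the lump sums at times before \<open>b\<close>, so that it agrees with \<open>m\<close> to the
  right of the scheduled time preceding \<open>b\<close> and extends \<open>m\<close> continuously to that time.
\<close>

private definition reward_after :: "real \<Rightarrow> real \<Rightarrow> real^'s" where
  "reward_after b s = integral {s..t} (\<lambda>u. P s u *v f u) +
     (\<Sum>j | j \<le> n \<and> b \<le> \<tau> j. P s (\<tau> j) *v h (\<tau> j))"

private lemma \<tau>_bounds:
  assumes "i \<le> n"
  shows "0 \<le> \<tau> i" "\<tau> i \<le> t"
  using \<tau>_mono[of 0 i] \<tau>_mono[of i n] assms by (simp_all add: \<tau>_0 \<tau>_n)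

private lemma \<tau>_pred_bounds:
  assumes "i \<in> {1..n}"
  shows "0 \<le> \<tau> (i - 1)" "\<tau> (i - 1) \<le> t"
  using \<tau>_bounds[of "i - 1"] assms by auto

private lemma f_measurable_Icc: "0 \<le> s \<Longrightarrow> set_borel_measurable lborel {s..s'} f"
  by (intro set_borel_measurable_subset[OF f_measurable]) auto

private lemma m_eq:
  assumes "0 \<le> s" "s \<le> t"
  shows "m s = integral {s..t} (\<lambda>u. P s u *v f u) +
    (\<Sum>j | j \<le> n \<and> s \<le> \<tau> j. P s (\<tau> j) *v h (\<tau> j))"
proof -
  have "set_integrable lborel {s..t} (\<lambda>u. P s u *v f u)"
    using assms f_bound by (intro P_mult_integrable[where D = D] f_measurable_Icc) auto
  moreover have "{j. j \<le> n \<and> s \<le> \<tau> j \<and> \<tau> j \<le> t} = {j. j \<le> n \<and> s \<le> \<tau> j}"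
    using \<tau>_bounds by auto
  ultimately show ?thesis
    by (simp add: m mean_reward_def set_borel_integral_eq_integral(2))
qed

text \<open>No scheduled time lies strictly between \<open>\<tau> (i - 1)\<close> and
  \<open>\<tau> i\<close>, so the lump sums still to come are the same for every \<open>s\<close> of
  the half-open interval. At the excluded left end, the lump sum of that time would be counted
  too.\<close>

private lemma m_eq_reward_after:
  assumes i: "i \<in> {1..n}" and s: "s \<in> {\<tau> (i - 1)<..\<tau> i}"
  shows "m s = reward_after (\<tau> i) s"
proof -
  have "s \<le> \<tau> j \<longleftrightarrow> \<tau> i \<le> \<tau> j" if "j \<le> n" for j
  proof
    assume "s \<le> \<tau> j"
    with s have "\<not> \<tau> j \<le> \<tau> (i - 1)"
      by auto
    then have "\<not> j \<le> i - 1"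
      using i \<tau>_mono[of j "i - 1"] by fastforce
    then show "\<tau> i \<le> \<tau> j"
      using that by (intro \<tau>_mono) auto
  qed (use s in auto)
  then have "{j. j \<le> n \<and> s \<le> \<tau> j} = {j. j \<le> n \<and> \<tau> i \<le> \<tau> j}"
    by auto
  moreover have "0 \<le> s" "s \<le> t"
    using \<tau>_pred_bounds[OF i] \<tau>_bounds[of i] i s by auto
  ultimately show ?thesis
    by (simp add: m_eq reward_after_def)
qed

private lemma reward_after_cocycle:
  assumes "i \<in> {1..n}" "\<tau> (i - 1) \<le> s" "s \<le> s'" "s' \<le> \<tau> i"
  shows "reward_after (\<tau> i) s =
    integral {s..s'} (\<lambda>u. P s u *v f u) + P s s' *v reward_after (\<tau> i) s'"
proof -
  have "0 \<le> s" "s' \<le> t"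
    using \<tau>_pred_bounds[OF assms(1)] \<tau>_bounds[of i] assms by auto
  show ?thesis
    unfolding reward_after_def
  proof (rule reward_cocycle)
    show "0 \<le> s" "s \<le> s'" "s' \<le> t"
      by fact+
    show "s' \<le> \<tau> j" if "j \<in> {j. j \<le> n \<and> \<tau> i \<le> \<tau> j}" for j
      using that assms by simp
    show "set_borel_measurable lborel {s..t} f"
      using \<open>0 \<le> s\<close> by (rule f_measurable_Icc)
    show "norm (f u) \<le> D" if "u \<in> {s..t}" for u
      using \<open>0 \<le> s\<close> that by (intro f_bound) auto
  qed
qed

text \<open>The hypotheses of the cocycle results for \<open>g = reward_after (\<tau> i)\<close>, in
  the order in which they are discharged by \<open>OF\<close>.\<close>

private lemma reward_after_assms:
  assumes "i \<in> {1..n}"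
  shows "0 \<le> \<tau> (i - 1)" "\<tau> (i - 1) \<le> \<tau> i"
    "set_borel_measurable lborel {\<tau> (i - 1)..\<tau> i} f"
    "\<And>u. u \<in> {\<tau> (i - 1)..\<tau> i} \<Longrightarrow> norm (f u) \<le> D"
    "\<And>s s'. \<lbrakk>\<tau> (i - 1) \<le> s; s \<le> s'; s' \<le> \<tau> i\<rbrakk> \<Longrightarrow> reward_after (\<tau> i) s =
      integral {s..s'} (\<lambda>u. P s u *v f u) + P s s' *v reward_after (\<tau> i) s'"
proof -
  show 0: "0 \<le> \<tau> (i - 1)"
    using \<tau>_pred_bounds[OF assms] by simp
  show "\<tau> (i - 1) \<le> \<tau> i"
    using assms by (intro \<tau>_mono) auto
  show "set_borel_measurable lborel {\<tau> (i - 1)..\<tau> i} f"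
    using 0 by (rule f_measurable_Icc)
  show "norm (f u) \<le> D" if "u \<in> {\<tau> (i - 1)..\<tau> i}" for u
    using 0 that by (intro f_bound) auto
  show "reward_after (\<tau> i) s =
      integral {s..s'} (\<lambda>u. P s u *v f u) + P s s' *v reward_after (\<tau> i) s'"
    if "\<tau> (i - 1) \<le> s" "s \<le> s'" "s' \<le> \<tau> i" for s s'
    using assms that by (rule reward_after_cocycle)
qed

lemma mean_reward_backward_equation:
  assumes i: "i \<in> {1..n}" and s: "s \<in> {\<tau> (i - 1)<..\<tau> i}"
  shows "m s = (LINT u:{s..\<tau> i}|lborel. f u) + (LINT u:{s..\<tau> i}|lborel. Q u *v m u) + m (\<tau> i)"
proof -
  have eq: "m u = reward_after (\<tau> i) u" if "u \<in> {s..\<tau> i}" for u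
    using that s by (intro m_eq_reward_after i) auto
  have "(LINT u:{s..\<tau> i}|lborel. Q u *v m u) = (LINT u:{s..\<tau> i}|lborel. Q u *v reward_after (\<tau> i) u)"
    by (intro set_lebesgue_integral_cong) (auto simp: eq)
  moreover have "reward_after (\<tau> i) s = (LINT u:{s..\<tau> i}|lborel. f u) +
      (LINT u:{s..\<tau> i}|lborel. Q u *v reward_after (\<tau> i) u) + reward_after (\<tau> i) (\<tau> i)"
    using s by (intro cocycle_backward_equation_lebesgue[OF reward_after_assms[OF i]]) auto
  ultimately show ?thesis
    using s by (simp add: eq)
qed

text \<open>The integral is over a single point, and every index left in the sum, possibly more than
  one, has time \<open>t\<close>, where \<open>h\<close> vanishes.\<close>

lemma mean_reward_at_horizon: "m t = 0"
proof -
  have "(\<Sum>j | j \<le> n \<and> t \<le> \<tau> j. P t (\<tau> j) *v h (\<tau> j)) = 0"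
    using \<tau>_bounds h_t by (intro sum.neutral) (auto dest!: order.antisym)
  then show ?thesis
    using \<tau>_bounds[of n] by (simp add: m_eq \<tau>_n)
qed

lemma mean_reward_has_vector_derivative_ae:
  assumes i: "i \<in> {1..n}"
  obtains N where "negligible N"
    and "\<And>s. \<lbrakk>s \<in> {\<tau> (i - 1)<..<\<tau> i}; s \<notin> N\<rbrakk> \<Longrightarrow>
      (m has_vector_derivative - (f s + Q s *v m s)) (at s)"
proof -
  obtain N where N: "negligible N" "\<And>s. \<lbrakk>s \<in> {\<tau> (i - 1)<..<\<tau> i}; s \<notin> N\<rbrakk> \<Longrightarrow>
      (reward_after (\<tau> i) has_vector_derivative - (f s + Q s *v reward_after (\<tau> i) s)) (at s)"
    using cocycle_differentiable_ae[OF reward_after_assms[OF i]] by blast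
  have "(m has_vector_derivative - (f s + Q s *v m s)) (at s)"
    if s: "s \<in> {\<tau> (i - 1)<..<\<tau> i}" and "s \<notin> N" for s
  proof (rule has_vector_derivative_transform_within_open)
    show "(reward_after (\<tau> i) has_vector_derivative - (f s + Q s *v m s)) (at s)"
      using N(2)[OF that] s m_eq_reward_after[OF i] by simp
    show "open {\<tau> (i - 1)<..<\<tau> i}" by simp
  qed (use s m_eq_reward_after[OF i] in auto)
  with N(1) that show ?thesis by blast
qed

lemma mean_reward_differentiable_AE: "AE s in lborel. s \<in> {0..t} \<longrightarrow> m differentiable (at s)"
proof -
  have "\<forall>i\<in>{1..n}. \<exists>N. negligible N \<and> (\<forall>s. s \<in> {\<tau> (i - 1)<..<\<tau> i} \<longrightarrow> s \<notin> N \<longrightarrow>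
      (m has_vector_derivative - (f s + Q s *v m s)) (at s))"
    using mean_reward_has_vector_derivative_ae by blast
  then obtain N where N: "\<And>i. i \<in> {1..n} \<Longrightarrow> negligible (N i)"
    "\<And>i s. \<lbrakk>i \<in> {1..n}; s \<in> {\<tau> (i - 1)<..<\<tau> i}; s \<notin> N i\<rbrakk> \<Longrightarrow>
      (m has_vector_derivative - (f s + Q s *v m s)) (at s)"
    unfolding bchoice_iff by blast
  show ?thesis
  proof (rule negligible_imp_AE_lborel)
    show "negligible ((\<Union>i\<in>{1..n}. N i) \<union> \<tau> ` {..n})"
      using N(1) by (intro negligible_Un negligible_Union) (auto simp: negligible_finite)
    fix s assume s: "s \<notin> (\<Union>i\<in>{1..n}. N i) \<union> \<tau> ` {..n}"
    show "s \<in> {0..t} \<longrightarrow> m differentiable (at s)"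
    proof
      assume "s \<in> {0..t}"
      \<comment> \<open>The least such index places \<open>s\<close>, which is not a scheduled time,
        in the open interval from \<open>\<tau> (i - 1)\<close> to \<open>\<tau> i\<close>; it is
        not 0 because \<open>\<tau> 0 = 0\<close>.\<close>
      define i where "i = (LEAST i. s \<le> \<tau> i)"
      have "s \<le> \<tau> n"
        using \<open>s \<in> {0..t}\<close> by (simp add: \<tau>_n)
      then have i: "s \<le> \<tau> i" "i \<le> n"
        unfolding i_def by (auto intro: LeastI Least_le)
      have "i \<noteq> 0"
      proof
        assume "i = 0"
        with i \<open>s \<in> {0..t}\<close> have "s = \<tau> 0" by (simp add: \<tau>_0)
        with s show False by auto
      qed
      then have "\<not> s \<le> \<tau> (i - 1)"
        unfolding i_def by (intro not_less_Least) simp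
      moreover have "s \<noteq> \<tau> i"
        using s i by auto
      ultimately have "(m has_vector_derivative - (f s + Q s *v m s)) (at s)"
        using i \<open>i \<noteq> 0\<close> s by (intro N(2)[of i]) auto
      then show "m differentiable (at s)"
        by (auto simp: differentiable_def has_vector_derivative_def)
    qed
  qed
qed

text \<open>Chain rule for the reflection of time, which cancels the minus sign. The exceptional set
  is reflected as well, and 0 is added to it because \<open>\<tau> i\<close> is not an interior
  point.\<close>

lemma mean_reward_derivative_AE:
  assumes i: "i \<in> {1..n}"
  shows "AE s in lborel. s \<in> {0..<\<tau> i - \<tau> (i - 1)} \<longrightarrow>
    ((\<lambda>s. m (\<tau> i - s)) has_vector_derivative f (\<tau> i - s) + Q (\<tau> i - s) *v m (\<tau> i - s)) (at s)"
proof -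
  obtain N where N: "negligible N" "\<And>s. \<lbrakk>s \<in> {\<tau> (i - 1)<..<\<tau> i}; s \<notin> N\<rbrakk> \<Longrightarrow>
      (m has_vector_derivative - (f s + Q s *v m s)) (at s)"
    using mean_reward_has_vector_derivative_ae[OF i] by blast
  show ?thesis
  proof (rule negligible_imp_AE_lborel)
    show "negligible ((\<lambda>s. \<tau> i - s) ` N \<union> {0})"
      using N(1) by (intro negligible_Un negligible_differentiable_image_negligible)
        (auto intro!: derivative_intros)
    fix s assume s: "s \<notin> (\<lambda>s. \<tau> i - s) ` N \<union> {0}"
    show "s \<in> {0..<\<tau> i - \<tau> (i - 1)} \<longrightarrow>
      ((\<lambda>s. m (\<tau> i - s)) has_vector_derivative f (\<tau> i - s) + Q (\<tau> i - s) *v m (\<tau> i - s)) (at s)"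
    proof
      assume s': "s \<in> {0..<\<tau> i - \<tau> (i - 1)}"
      have "\<tau> i - s \<notin> N"
        using s by (auto simp: image_iff)
      with s s' have "(m has_vector_derivative
         - (f (\<tau> i - s) + Q (\<tau> i - s) *v m (\<tau> i - s))) (at (\<tau> i - s))"
        by (intro N(2)) auto
      moreover have "((\<lambda>s. \<tau> i - s) has_vector_derivative -1) (at s)"
        by (auto intro!: derivative_eq_intros)
      ultimately have "((\<lambda>s. m (\<tau> i - s)) has_vector_derivative
          -1 *\<^sub>R - (f (\<tau> i - s) + Q (\<tau> i - s) *v m (\<tau> i - s))) (at s)"
        using vector_diff_chain_at[where f = "\<lambda>s. \<tau> i - s" and g = m] by (simp only: o_def)
      then show "((\<lambda>s. m (\<tau> i - s)) has_vector_derivative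
          f (\<tau> i - s) + Q (\<tau> i - s) *v m (\<tau> i - s)) (at s)"
        by (simp add: add.commute)
    qed
  qed
qed

lemma mean_reward_jump:
  assumes i: "i \<in> {1..n}"
  shows "\<exists>L. (if \<tau> i = t then L = 0 else (m \<longlongrightarrow> L) (at_right (\<tau> i))) \<and> m (\<tau> i) = h (\<tau> i) + L"
proof (cases "\<tau> i = t")
  \<comment> \<open>This includes \<open>i = n\<close> and any earlier index whose time is already
    \<open>t\<close>.\<close>
  case True
  then show ?thesis
    by (simp add: mean_reward_at_horizon h_t)
next
  case False
  let ?b = "\<tau> (Suc i)"
  have \<tau>i: "0 \<le> \<tau> i" "\<tau> i < t"
    using \<tau>_bounds[of i] i False by auto
  then have "i \<noteq> n"
    using \<tau>_n by auto
  with i have Suc_i: "Suc i \<in> {1..n}" by auto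
  with \<tau>i have less: "\<tau> i < ?b"
    by (intro \<tau>_strict) auto
  have "(reward_after ?b \<longlongrightarrow> reward_after ?b (\<tau> i)) (at_right (\<tau> i))"
    using cocycle_right_limit[OF reward_after_assms[OF Suc_i]] less by simp
  moreover have "\<forall>\<^sub>F s in at_right (\<tau> i). reward_after ?b s = m s"
    using m_eq_reward_after[OF Suc_i] by (intro eventually_at_rightI[OF _ less]) auto
  ultimately have "(m \<longlongrightarrow> reward_after ?b (\<tau> i)) (at_right (\<tau> i))"
    by (rule Lim_transform_eventually)
  moreover have "m (\<tau> i) = h (\<tau> i) + reward_after ?b (\<tau> i)"
  proof -
    \<comment> \<open>Before \<open>t\<close> the schedule is strictly increasing, so
      \<open>i\<close> is the only index with time \<open>\<tau> i\<close>. Hence exactly one lump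
      sum drops out, and \<open>P_same\<close> makes it \<open>h (\<tau> i)\<close>.\<close>
    have "\<tau> i \<le> \<tau> j \<longleftrightarrow> j = i \<or> ?b \<le> \<tau> j" if "j \<le> n" for j
      using \<tau>_strict[of j i] \<tau>_mono[of j i] \<tau>_mono[of "Suc i" j] \<tau>i i that less
      by (cases i j rule: linorder_cases) auto
    then have "{j. j \<le> n \<and> \<tau> i \<le> \<tau> j} = insert i {j. j \<le> n \<and> ?b \<le> \<tau> j}"
      using i by auto
    moreover have "i \<notin> {j. j \<le> n \<and> ?b \<le> \<tau> j}"
      using less by simp
    ultimately show ?thesis
      using \<tau>i by (simp add: m_eq reward_after_def P_same)
  qed
  ultimately show ?thesis
    using False by auto
qed

end
end

section \<open>Reduction of the assumptions to measurability and uniform bounds\<close>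

theorem proposition7:
  fixes M :: "'w measure"
    and X :: "real \<Rightarrow> 'w \<Rightarrow> 's::finite"
    and Q :: "real \<Rightarrow> real^'s^'s"
    and P :: "real \<Rightarrow> real \<Rightarrow> real^'s^'s"
    and r \<beta> :: "real \<Rightarrow> 's \<Rightarrow> real"
    and G :: "real \<Rightarrow> 's \<Rightarrow> 's \<Rightarrow> real \<Rightarrow> real"
    and H K :: "real \<Rightarrow> 's \<Rightarrow> real \<Rightarrow> real"
    and T \<tau> :: "nat \<Rightarrow> real"
    and t :: real
    and n\<^sub>0 :: nat
    and rt h m :: "real \<Rightarrow> real^'s"
  assumes "markov_reward_process M X Q P G H K T"
    and "A1 Q r \<beta> G K"
    and "A2 Q"
    and "A3 Q"
    and "A4 Q r \<beta> G H K"
    and "A5 T"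
    and "t > 0"
    and n0: "n\<^sub>0 = num_scheduled T t + 1"
    and tau: "\<tau> = truncated_schedule T t"
    and rt: "rt = r_tilde Q r \<beta> G K"
    and h: "h = lump_mean H t"
    and m: "m = mean_reward P rt h \<tau> n\<^sub>0 t"
  shows "(\<forall>i\<in>{1..n\<^sub>0}. \<forall>s\<in>{\<tau> (i - 1)<..\<tau> i}.
            m s = (LINT u:{s..\<tau> i}|lborel. rt u)
                + (LINT u:{s..\<tau> i}|lborel. Q u *v m u) + m (\<tau> i)) \<and>
         m (\<tau> n\<^sub>0) = 0 \<and>
         (AE s in lborel. s \<in> {0..t} \<longrightarrow> m differentiable (at s)) \<and>
         (\<forall>i\<in>{1..n\<^sub>0}. AE s in lborel. s \<in> {0..<\<tau> i - \<tau> (i - 1)} \<longrightarrow>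
            ((\<lambda>s. m (\<tau> i - s)) has_vector_derivative
               rt (\<tau> i - s) + Q (\<tau> i - s) *v m (\<tau> i - s)) (at s)) \<and>
         (\<forall>i\<in>{1..n\<^sub>0}. \<exists>L. (if \<tau> i = t then L = 0 else (m \<longlongrightarrow> L) (at_right (\<tau> i))) \<and>
            m (\<tau> i) = h (\<tau> i) + L)"
proof -
  interpret markov_reward_process M X Q P G H K T by fact
  have "bounded (Q ` {0..})"
    using rate_matrix_Q \<open>A2 Q\<close> \<open>A3 Q\<close> by (intro bounded_vec bounded_rate_entries)
  then obtain B where B: "\<And>u. 0 \<le> u \<Longrightarrow> norm (Q u) \<le> B"
    unfolding bounded_iff by auto
  have "set_borel_measurable lborel {0..} Q"
    using \<open>A1 Q r \<beta> G K\<close>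
    by (auto simp: set_borel_measurable_nonneg_reals_iff A1_def intro!: borel_measurable_vec)
  \<comment> \<open>\<open>B\<close> comes from the assumptions on the rates; the bound on
    \<open>P\<close> comes from stochasticity alone.\<close>
  with B interpret bounded_rates M X Q P B "real CARD('s) * real CARD('s)"
    by unfold_locales (auto intro: norm_P_le_card)
  have "bounded (rt ` {0..})"
    unfolding rt using rate_matrix_Q df_G df_K assms(3-5) by (rule bounded_r_tilde)
  then obtain D where D: "\<And>u. 0 \<le> u \<Longrightarrow> norm (rt u) \<le> D"
    unfolding bounded_iff by auto
  have rt_measurable: "set_borel_measurable lborel {0..} rt"
    unfolding rt using df_G df_K \<open>A1 Q r \<beta> G K\<close> by (rule r_tilde_measurable)
  have h_t: "h t = 0"
    by (simp add: h lump_mean_def)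
  note schedule = truncated_schedule_properties[OF T_0 T_strict_mono T_unbounded \<open>t > 0\<close>, folded n0 tau]
  note reward = rt_measurable D h_t m schedule
  show ?thesis
  proof (intro conjI ballI)
    show "m (\<tau> n\<^sub>0) = 0"
      using mean_reward_at_horizon[OF reward] by (simp add: schedule(2))
  qed (rule mean_reward_backward_equation[OF reward] mean_reward_differentiable_AE[OF reward]
      mean_reward_derivative_AE[OF reward] mean_reward_jump[OF reward]; assumption)+
qed

end
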